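(* Let $n\in\mathbb{Z}$ with $|n|\geq1$, $\alpha>0$, $R>0$, and let $Q_0>0$. Consider the $n$-vortex equation $$(ru_r)_r-\frac{n^2}{r}u+\frac{2ru^3}{1+\alpha u^2}-2\kappa ru=0\ \text{ on }(0,R),\qquad u(0)=0,\quad u(R)=0,$$ for an unknown function $u$ and unknown constant $\kappa\in\mathbb{R}$, subject to the prescribed energy flux $Q(u)=Q_0$ and the finite-energy condition $\mathcal{E}(u)<\infty$. (i) There exists a solution pair $(u,\kappa)$ of this problem satisfying $u(r)>0$ for all $r\in(0,R)$. (ii) If $n^2+2r^2\kappa>0$ for all $r\in[0,R]$, then there exists no nontrivial finite-energy solution $u$ of the $n$-vortex equation with this $\kappa$ satisfying $Q(u)=Q_0\leq 1/4$.
   Context: The energy flux is $Q(u)=2\pi\int_0^R ru^2\,dr$ and the energy is $\mathcal{E}(u)=\frac12\int_0^R\left\{ru_r^2+\frac1r u^2+r\ln(1+\alpha u^2)\right\}dr$, for real-valued $u$ on $[0,R]$ (absolutely continuous, $u_r=du/dr$). *)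

theory Defs
  imports "HOL-Analysis.Analysis"
begin

definition flux :: "real \<Rightarrow> (real \<Rightarrow> real) \<Rightarrow> real" where
  "flux R u = 2 * pi * (\<integral>r\<in>{0..R}. r * (u r)\<^sup>2 \<partial>lborel)"

definition energy_density :: "real \<Rightarrow> (real \<Rightarrow> real) \<Rightarrow> real \<Rightarrow> real" where
  "energy_density \<alpha> u r = r * (deriv u r)\<^sup>2 + (u r)\<^sup>2 / r + r * ln (1 + \<alpha> * (u r)\<^sup>2)"

text \<open>Finite energy: the (nonnegative) energy integrand is Lebesgue integrable on (0,R),
  i.e. E(u) = 1/2 int_0^R (...) dr < infinity.\<close>
definition finite_energy :: "real \<Rightarrow> real \<Rightarrow> (real \<Rightarrow> real) \<Rightarrow> bool" where
  "finite_energy \<alpha> R u \<longleftrightarrow>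
     set_integrable lborel {0<..<R} (energy_density \<alpha> u)"

definition vortex_solution ::
  "int \<Rightarrow> real \<Rightarrow> real \<Rightarrow> real \<Rightarrow> (real \<Rightarrow> real) \<Rightarrow> bool" where
  "vortex_solution n \<alpha> R \<kappa> u \<longleftrightarrow>
     continuous_on {0..R} u \<and> u 0 = 0 \<and> u R = 0 \<and>
     (\<forall>r\<in>{0<..<R}. u differentiable (at r) \<and>
        ((\<lambda>s. s * deriv u s) has_real_derivative
           ((real_of_int n)\<^sup>2 / r * u r - 2 * r * (u r)^3 / (1 + \<alpha> * (u r)\<^sup>2)
            + 2 * \<kappa> * r * u r)) (at r))"

end

theory Submission
  imports Defs
begin

text \<open>
  Existence is by two-parameter shooting. Put \<open>m = \<bar>n\<bar>\<close> and \<open>u = a r\<^sup>m y\<close> with \<open>y 0 = 1\<close>; the equation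
  becomes a regular integral equation for \<open>y\<close> whose nonlinearity is globally Lipschitz, since the
  saturable term is, with a constant that does not depend on the amplitude \<open>a\<close>. On a suitable
  rectangle of parameters \<open>(a, \<kappa>)\<close> the minimum of \<open>y\<close> over \<open>[0, R]\<close> is nonpositive for \<open>\<kappa>\<close> very negative
  and positive for \<open>\<kappa> = 1 / \<alpha>\<close>, whereas the flux is below \<open>Q0\<close> for \<open>a = 0\<close> and at least \<open>Q0\<close> for \<open>a\<close>
  large. The Poincare-Miranda theorem yields parameters for which the minimum is \<open>0\<close> and the flux is
  \<open>Q0\<close>. As \<open>y\<close> has no double zero, the minimum is attained at \<open>R\<close> only.

  For nonexistence, multiply the equation by \<open>u\<close> and integrate: the integral of
  \<open>r u'\<^sup>2 + (n\<^sup>2 / r + 2 \<kappa> r) u\<^sup>2\<close> is at most that of \<open>2 r u\<^sup>4\<close>, and the latter is at most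
  \<open>8 (\<integral> r u\<^sup>2) (\<integral> r u'\<^sup>2)\<close>, which small flux makes smaller than \<open>\<integral> r u'\<^sup>2\<close>.
\<close>

section \<open>The integral equation\<close>

text \<open>For \<open>x = (p, r)\<close> with \<open>r > 0\<close> this is \<open>r ^ (-k)\<close>
  times the integral of \<open>t ^ k * h (p, t)\<close> over \<open>{0..r}\<close>, rescaled to the
  unit interval. Nothing is divided by \<open>r\<close>, and joint continuity in parameter and
  radius comes from a fixed domain of integration.\<close>

definition shoot_deriv :: "nat \<Rightarrow> ('p \<times> real \<Rightarrow> real) \<Rightarrow> 'p \<times> real \<Rightarrow> real" where
  "shoot_deriv k h x = snd x * integral {0..1} (\<lambda>s. s ^ k * h (fst x, snd x * s))"

text \<open>Together with \<open>shoot_deriv\<close> this inverts the operator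
  \<open>y'' + k y' / r\<close> with zero value and zero slope at \<open>0\<close>.\<close>

definition shoot :: "nat \<Rightarrow> ('p \<times> real \<Rightarrow> real) \<Rightarrow> 'p \<times> real \<Rightarrow> real" where
  "shoot k h x = snd x * integral {0..1} (\<lambda>\<sigma>. shoot_deriv k h (fst x, snd x * \<sigma>))"

lemma continuous_on_shoot_deriv:
  fixes h :: "'p::topological_space \<times> real \<Rightarrow> real"
  assumes "continuous_on UNIV h"
  shows "continuous_on UNIV (shoot_deriv k h)"
proof -
  have "continuous_on (UNIV \<times> cbox 0 1) (\<lambda>(x, s::real). s ^ k * h (fst x, snd x * s))"
    by (auto simp: case_prod_unfold intro!: continuous_intros continuous_on_compose2[OF assms])
  from integral_continuous_on_param[OF this]
  show ?thesis unfolding shoot_deriv_def box_real by (intro continuous_intros)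
qed

lemma continuous_on_shoot:
  fixes h :: "'p::topological_space \<times> real \<Rightarrow> real"
  assumes "continuous_on UNIV h"
  shows "continuous_on UNIV (shoot k h)"
proof -
  have "continuous_on (UNIV \<times> cbox 0 1) (\<lambda>(x, s::real). shoot_deriv k h (fst x, snd x * s))"
    by (auto simp: case_prod_unfold intro!: continuous_intros
      continuous_on_compose2[OF continuous_on_shoot_deriv[OF assms]])
  from integral_continuous_on_param[OF this]
  show ?thesis unfolding shoot_def box_real by (intro continuous_intros)
qed

text \<open>The factor \<open>\<bar>t\<bar>\<close> from the kernel is kept because it makes the
  weight integrable in closed form in \<open>shoot_diff_le\<close>.\<close>

lemma shoot_deriv_diff_le:
  fixes h1 h2 :: "'p::topological_space \<times> real \<Rightarrow> real"
  assumes c1: "continuous_on UNIV h1" and c2: "continuous_on UNIV h2" and "L > 0"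
    and d: "\<And>x. \<bar>h1 x - h2 x\<bar> \<le> d * exp (L * (snd x)\<^sup>2)"
  shows "\<bar>shoot_deriv k h1 (p, t) - shoot_deriv k h2 (p, t)\<bar> \<le> \<bar>t\<bar> * (d * exp (L * t\<^sup>2))"
proof -
  have d0: "d \<ge> 0" using d[of "(p,0)"] by simp
  let ?f = "\<lambda>h s. s ^ k * h (p, t * s)"
  have i1: "?f h1 integrable_on {0..1}"
    by (intro integrable_continuous_real continuous_intros continuous_on_compose2[OF c1]) auto
  have i2: "?f h2 integrable_on {0..1}"
    by (intro integrable_continuous_real continuous_intros continuous_on_compose2[OF c2]) auto
  have "norm (integral {0..1} (\<lambda>s. ?f h1 s - ?f h2 s)) \<le> integral {0..1} (\<lambda>s::real. d * exp (L * t\<^sup>2))"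
  proof (rule integral_norm_bound_integral)
    fix s :: real assume s: "s \<in> {0..1}"
    have "\<bar>s ^ k * (h1 (p, t * s) - h2 (p, t * s))\<bar> \<le> 1 * (d * exp (L * (t * s)\<^sup>2))"
      unfolding abs_mult using d[of "(p, t * s)"] s by (intro mult_mono) (auto intro: power_le_one)
    also have "(t * s)\<^sup>2 \<le> t\<^sup>2" using s by (simp add: power_mult_distrib mult_left_le power_le_one)
    then have "1 * (d * exp (L * (t * s)\<^sup>2)) \<le> d * exp (L * t\<^sup>2)"
      using d0 \<open>L > 0\<close> by (simp add: mult_left_mono)
    finally show "norm (?f h1 s - ?f h2 s) \<le> d * exp (L * t\<^sup>2)" by (simp add: algebra_simps)
  qed (use i1 i2 in \<open>auto intro: integrable_diff\<close>)
  then have "\<bar>integral {0..1} (?f h1) - integral {0..1} (?f h2)\<bar> \<le> d * exp (L * t\<^sup>2)"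
    using i1 i2 by (simp add: integral_diff)
  then show ?thesis
    unfolding shoot_deriv_def fst_conv snd_conv right_diff_distrib[symmetric] abs_mult
    by (rule mult_left_mono) simp
qed

text \<open>A primitive of \<open>t * exp (L * t\<^sup>2)\<close> is
  \<open>exp (L * t\<^sup>2) / (2 * L)\<close>, so \<open>shoot\<close> gains the factor
  \<open>1 / (2 * L)\<close> in the weighted norm, uniformly in the radius.\<close>

lemma shoot_diff_le:
  fixes h1 h2 :: "'p::topological_space \<times> real \<Rightarrow> real"
  assumes c1: "continuous_on UNIV h1" and c2: "continuous_on UNIV h2" and "L > 0"
    and d: "\<And>x. \<bar>h1 x - h2 x\<bar> \<le> d * exp (L * (snd x)\<^sup>2)"
  shows "\<bar>shoot k h1 x - shoot k h2 x\<bar> \<le> d / (2 * L) * exp (L * (snd x)\<^sup>2)"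
proof -
  obtain p r where x: "x = (p, r)" by (cases x)
  have d0: "d \<ge> 0" using d[of "(p,0)"] by simp
  let ?f = "\<lambda>h \<sigma>. shoot_deriv k h (p, r * \<sigma>)"
  have i1: "?f h1 integrable_on {0..1}"
    by (intro integrable_continuous_real continuous_intros
      continuous_on_compose2[OF continuous_on_shoot_deriv[OF c1]]) auto
  have i2: "?f h2 integrable_on {0..1}"
    by (intro integrable_continuous_real continuous_intros
      continuous_on_compose2[OF continuous_on_shoot_deriv[OF c2]]) auto
  let ?b = "\<lambda>\<sigma>. r * r * \<sigma> * (d * exp (L * (r * \<sigma>)\<^sup>2))"
  have "(?b has_integral (d / (2 * L) * exp (L * (r * 1)\<^sup>2) - d / (2 * L) * exp (L * (r * 0)\<^sup>2))) {0..1}"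
  proof (rule fundamental_theorem_of_calculus)
    fix \<sigma> :: real assume "\<sigma> \<in> {0..1}"
    have "((\<lambda>\<sigma>. d / (2 * L) * exp (L * (r * \<sigma>)\<^sup>2)) has_real_derivative ?b \<sigma>) (at \<sigma> within {0..1})"
      using \<open>L > 0\<close> by (auto intro!: derivative_eq_intros simp: field_simps power2_eq_square)
    then show "((\<lambda>\<sigma>. d / (2 * L) * exp (L * (r * \<sigma>)\<^sup>2)) has_vector_derivative ?b \<sigma>) (at \<sigma> within {0..1})"
      by (simp add: has_real_derivative_iff_has_vector_derivative)
  qed simp
  note b = this
  have "norm (integral {0..1} (\<lambda>\<sigma>. r * (?f h1 \<sigma> - ?f h2 \<sigma>))) \<le> integral {0..1} ?b"
  proof (rule integral_norm_bound_integral)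
    fix \<sigma> :: real assume s: "\<sigma> \<in> {0..1}"
    have "\<bar>r * (?f h1 \<sigma> - ?f h2 \<sigma>)\<bar> \<le> \<bar>r\<bar> * (\<bar>r * \<sigma>\<bar> * (d * exp (L * (r * \<sigma>)\<^sup>2)))"
      unfolding abs_mult[of r "_ - _"]
      by (intro mult_left_mono shoot_deriv_diff_le c1 c2 d \<open>L > 0\<close>) auto
    also have "\<dots> = ?b \<sigma>" using s by (simp add: abs_mult)
    finally show "norm (r * (?f h1 \<sigma> - ?f h2 \<sigma>)) \<le> ?b \<sigma>" by simp
  qed (use i1 i2 b in \<open>auto intro!: integrable_diff integrable_on_mult_right\<close>)
  also have "integral {0..1} ?b \<le> d / (2 * L) * exp (L * r\<^sup>2)"
    using integral_unique[OF b] d0 \<open>L > 0\<close> by simp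
  finally show ?thesis
    using i1 i2 by (simp add: x shoot_def integral_diff right_diff_distrib integrable_on_mult_right)
qed

text \<open>The Picard operator contracts for the weighted norm \<open>sup \<bar>w (p, r)\<bar> exp (- L r\<^sup>2)\<close>;
  treating the parameter as a variable of the unknown gives joint continuity at once.\<close>

lemma picard_family:
  fixes G :: "'p::metric_space \<times> real \<Rightarrow> real \<Rightarrow> real"
  assumes cont: "continuous_on UNIV (\<lambda>(x, y). G x y)" and "L > 0"
    and lip: "\<And>x y z. \<bar>G x y - G x z\<bar> \<le> L * \<bar>y - z\<bar>" and zero: "\<And>x. G x 0 = 0"
  obtains w M where "continuous_on UNIV w" "\<And>x. \<bar>w x\<bar> \<le> M * exp (L * (snd x)\<^sup>2)"
    "\<And>x. w x = 1 + shoot k (\<lambda>z. G z (w z)) x"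
proof -
  define W :: "(('p \<times> real) \<Rightarrow>\<^sub>C real) \<Rightarrow> 'p \<times> real \<Rightarrow> real"
    where "W v x = exp (L * (snd x)\<^sup>2) * apply_bcontfun v x" for v x
  \<comment> \<open>Conjugation by the weight turns the weighted norm into the sup norm on bounded
    continuous functions, a complete space.\<close>
  define S where "S v = (\<lambda>x. exp (- (L * (snd x)\<^sup>2)) * (1 + shoot k (\<lambda>z. G z (W v z)) x))" for v
  have W: "continuous_on UNIV (W v)" for v
    unfolding W_def by (intro continuous_intros continuous_on_apply_bcontfun)
  have GW: "continuous_on UNIV (\<lambda>z. G z (W v z))" for v
    using continuous_on_compose2[OF cont, of UNIV "\<lambda>z. (z, W v z)"] W
    by (simp add: continuous_on_Pair continuous_on_id)
  \<comment> \<open>The Lipschitz constant \<open>L\<close> of \<open>G\<close> meets the gain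
    \<open>1 / (2 * L)\<close>, which leaves the contraction factor \<open>1 / 2\<close>.\<close>
  have diff: "\<bar>shoot k (\<lambda>z. G z (W v1 z)) x - shoot k (\<lambda>z. G z (W v2 z)) x\<bar>
      \<le> dist v1 v2 / 2 * exp (L * (snd x)\<^sup>2)" for v1 v2 x
  proof -
    have "\<bar>G z (W v1 z) - G z (W v2 z)\<bar> \<le> L * dist v1 v2 * exp (L * (snd z)\<^sup>2)" for z
    proof -
      have "\<bar>W v1 z - W v2 z\<bar> = exp (L * (snd z)\<^sup>2) * dist (apply_bcontfun v1 z) (apply_bcontfun v2 z)"
        by (simp add: W_def dist_real_def abs_mult right_diff_distrib[symmetric])
      also have "\<dots> \<le> exp (L * (snd z)\<^sup>2) * dist v1 v2"
        by (intro mult_left_mono dist_bounded) auto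
      finally have "L * \<bar>W v1 z - W v2 z\<bar> \<le> L * (exp (L * (snd z)\<^sup>2) * dist v1 v2)"
        using \<open>L > 0\<close> by simp
      with lip[of z "W v1 z" "W v2 z"] show ?thesis by (simp add: mult_ac)
    qed
    from shoot_diff_le[OF GW GW \<open>L > 0\<close> this, of k x] \<open>L > 0\<close> show ?thesis by simp
  qed
  have W0: "W 0 = (\<lambda>_. 0)" by (simp add: W_def fun_eq_iff)
  have z0: "shoot k (\<lambda>z. G z (W 0 z)) x = 0" for x
    by (simp add: W0 zero shoot_def shoot_deriv_def)
  have Sdiff: "\<bar>S v1 x - S v2 x\<bar> \<le> dist v1 v2 / 2" for v1 v2 x
  proof -
    have "\<bar>S v1 x - S v2 x\<bar> = exp (- (L * (snd x)\<^sup>2)) * \<bar>shoot k (\<lambda>z. G z (W v1 z)) x - shoot k (\<lambda>z. G z (W v2 z)) x\<bar>"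
      by (simp add: S_def abs_mult right_diff_distrib[symmetric])
    also have "\<dots> \<le> exp (- (L * (snd x)\<^sup>2)) * (dist v1 v2 / 2 * exp (L * (snd x)\<^sup>2))"
      by (intro mult_left_mono diff) auto
    finally show ?thesis by (simp add: exp_minus field_simps)
  qed
  \<comment> \<open>As \<open>G\<close> vanishes at \<open>0\<close>, \<open>S 0\<close> is just the
    inverse weight. Its boundedness and the contraction estimate make every \<open>S v\<close>
    bounded.\<close>
  have S0: "\<bar>S 0 x\<bar> \<le> 1" for x
    using \<open>L > 0\<close> by (simp add: S_def z0)
  have SB: "S v \<in> bcontfun" for v
  proof (rule bcontfun_normI)
    show "continuous_on UNIV (S v)"
      unfolding S_def by (intro continuous_intros continuous_on_shoot GW)
    show "norm (S v x) \<le> 1 + dist v 0 / 2" for x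
      using Sdiff[of v x 0] S0[of x] unfolding real_norm_def by linarith
  qed
  define T where "T v = Bcontfun (S v)" for v
  have T: "apply_bcontfun (T v) = S v" for v
    by (simp add: T_def Bcontfun_inverse SB)
  have "\<exists>!v. T v = v"
  proof (rule banach_fix_type[of "1/2" T])
    show "\<forall>x y. dist (T x) (T y) \<le> 1 / 2 * dist x y"
      by (intro allI dist_bound) (use Sdiff in \<open>simp add: T dist_real_def\<close>)
  qed auto
  then obtain v where v: "T v = v" by auto
  show ?thesis
  proof (rule that[of "W v" "norm v"])
    show "\<bar>W v x\<bar> \<le> norm v * exp (L * (snd x)\<^sup>2)" for x
      using norm_bounded[of v x] by (simp add: W_def abs_mult mult.commute)
    show "W v x = 1 + shoot k (\<lambda>z. G z (W v z)) x" for x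
    proof -
      have "W v x = exp (L * (snd x)\<^sup>2) * S v x"
        using T[of v] v by (simp add: W_def)
      then show ?thesis by (simp add: S_def exp_minus)
    qed
  qed (rule W)
qed

section \<open>Differential equations satisfied by the shooting integrals\<close>

lemma scaled_integral_eq:
  fixes h :: "real \<Rightarrow> real"
  assumes h: "continuous_on UNIV h" and "r \<ge> 0"
  shows "r * integral {0..1} (\<lambda>s. h (r * s)) = integral {0..r} h"
proof -
  let ?H = "\<lambda>x. integral {0..x} h"
  have "((\<lambda>s. r * h (r * s)) has_integral (?H (r * 1) - ?H (r * 0))) {0..1}"
  proof (rule fundamental_theorem_of_calculus)
    fix s :: real assume s: "s \<in> {0..1}"
    have "(?H has_real_derivative h (r * s)) (at (r * s) within {0..r})"
      using s \<open>r \<ge> 0\<close> by (intro integral_has_real_derivative continuous_on_subset[OF h])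
        (auto simp: mult_left_le)
    then have "(?H has_real_derivative h (r * s)) (at (r * s) within (\<lambda>s. r * s) ` {0..1})"
      by (rule has_field_derivative_subset) (use \<open>r \<ge> 0\<close> in \<open>auto simp: mult_left_le\<close>)
    from DERIV_image_chain[OF this, of r]
    have "((\<lambda>s. ?H (r * s)) has_real_derivative h (r * s) * r) (at s within {0..1})"
      by (simp add: o_def)
    then show "((\<lambda>s. ?H (r * s)) has_vector_derivative r * h (r * s)) (at s within {0..1})"
      by (simp add: has_real_derivative_iff_has_vector_derivative mult.commute)
  qed simp
  from integral_unique[OF this] show ?thesis by simp
qed

lemma integral_has_real_derivative_at:
  fixes h :: "real \<Rightarrow> real"
  assumes h: "continuous_on UNIV h" and "r > 0"
  shows "((\<lambda>x. integral {0..x} h) has_real_derivative h r) (at r)"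
proof -
  have "((\<lambda>x. integral {0..x} h) has_real_derivative h r) (at r within {0..r+1})"
    using \<open>r > 0\<close> by (intro integral_has_real_derivative continuous_on_subset[OF h]) auto
  moreover have "at r within {0..r+1} = at r"
    using \<open>r > 0\<close> by (intro at_within_interior) auto
  ultimately show ?thesis by simp
qed

lemma shoot_has_derivative:
  fixes h :: "'p::topological_space \<times> real \<Rightarrow> real"
  assumes h: "continuous_on UNIV h" and "r > 0"
  shows "((\<lambda>r. shoot k h (p, r)) has_real_derivative shoot_deriv k h (p, r)) (at r)"
proof -
  have c: "continuous_on UNIV (\<lambda>t. shoot_deriv k h (p, t))"
    by (intro continuous_on_compose2[OF continuous_on_shoot_deriv[OF h]] continuous_intros) auto
  have "shoot k h (p, x) = integral {0..x} (\<lambda>t. shoot_deriv k h (p, t))" if "x \<in> {0<..}" for x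
    using scaled_integral_eq[OF c, of x] that by (simp add: shoot_def)
  then show ?thesis
    using integral_has_real_derivative_at[OF c \<open>r > 0\<close>] \<open>r > 0\<close>
    by (subst has_field_derivative_cong_ev[where g="\<lambda>x. integral {0..x} (\<lambda>t. shoot_deriv k h (p, t))", OF refl _ refl])
      (auto intro!: eventually_mono[OF eventually_nhds_in_open[of "{0<..}" r]])
qed

text \<open>Undoing the rescaling writes \<open>shoot_deriv\<close> as an integral over
  \<open>{0..r}\<close> divided by \<open>r ^ k\<close>; the quotient rule then yields the damping
  term.\<close>

lemma shoot_deriv_has_derivative:
  fixes h :: "'p::topological_space \<times> real \<Rightarrow> real"
  assumes h: "continuous_on UNIV h" and "r > 0"
  shows "((\<lambda>r. shoot_deriv k h (p, r)) has_real_derivative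
     h (p, r) - k * shoot_deriv k h (p, r) / r) (at r)"
proof -
  let ?D = "\<lambda>r. shoot_deriv k h (p, r)"
  let ?h = "\<lambda>t. t ^ k * h (p, t)"
  have c: "continuous_on UNIV ?h"
    by (intro continuous_intros continuous_on_compose2[OF h]) auto
  have D': "integral {0..x} ?h = x ^ k * ?D x" if "x > 0" for x
  proof -
    have "integral {0..x} ?h = x * integral {0..1} (\<lambda>s. x ^ k * (s ^ k * h (p, x * s)))"
      using scaled_integral_eq[OF c, of x] that by (simp add: power_mult_distrib mult.assoc)
    also have "\<dots> = x ^ k * ?D x" by (simp add: shoot_deriv_def)
    finally show ?thesis .
  qed
  then have D: "?D x = integral {0..x} ?h / x ^ k" if "x > 0" for x
    using that by simp
  have "((\<lambda>x. integral {0..x} ?h / x ^ k) has_real_derivative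
      (?h r * r ^ k - integral {0..r} ?h * (real k * r ^ (k - 1))) / (r ^ k * r ^ k)) (at r)"
    using \<open>r > 0\<close> by (auto intro!: derivative_eq_intros integral_has_real_derivative_at[OF c])
  moreover have "(?h r * r ^ k - integral {0..r} ?h * (real k * r ^ (k - 1))) / (r ^ k * r ^ k)
      = h (p, r) - k * ?D r / r"
    unfolding D'[OF \<open>r > 0\<close>] using \<open>r > 0\<close> by (cases k) (auto simp: field_simps)
  ultimately show ?thesis
    using \<open>r > 0\<close>
    by (subst has_field_derivative_cong_ev[where g="\<lambda>x. integral {0..x} ?h / x ^ k", OF refl _ refl])
      (auto intro!: eventually_mono[OF eventually_nhds_in_open[of "{0<..}" r]] simp: D)
qed

section \<open>Radial profiles\<close>

text \<open>The right-hand side of the profile equation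
  \<open>y'' + (2 m + 1) y' / r = react\<close>. The factor
  \<open>a\<^sup>2 * r ^ (2 * m) * y\<^sup>2\<close> is \<open>u\<^sup>2\<close> for
  \<open>u = a r\<^sup>m y\<close>, so the formula stays meaningful at \<open>a = 0\<close> and
  \<open>r = 0\<close>.\<close>

definition react :: "nat \<Rightarrow> real \<Rightarrow> real \<Rightarrow> real \<Rightarrow> real \<Rightarrow> real \<Rightarrow> real" where
  "react m \<alpha> a \<kappa> r y = 2 * \<kappa> * y - 2 * (a\<^sup>2 * r ^ (2 * m)) * y ^ 3 / (1 + \<alpha> * (a\<^sup>2 * r ^ (2 * m)) * y\<^sup>2)"

text \<open>The difference quotient is \<open>(1 - \<beta> x y) / ((1 + \<beta> x\<^sup>2) (1 +
  \<beta> y\<^sup>2))\<close>, and \<open>2 \<bar>x y\<bar> \<le> x\<^sup>2 + y\<^sup>2\<close>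
  bounds its modulus by \<open>1\<close> whatever the size of \<beta>.\<close>

lemma saturated_lipschitz:
  fixes \<beta> x y :: real
  assumes "\<beta> \<ge> 0"
  shows "\<bar>x / (1 + \<beta> * x\<^sup>2) - y / (1 + \<beta> * y\<^sup>2)\<bar> \<le> \<bar>x - y\<bar>"
proof -
  have p: "1 + \<beta> * x\<^sup>2 > 0" "1 + \<beta> * y\<^sup>2 > 0" using assms by (auto simp: add_pos_nonneg)
  let ?d = "(1 + \<beta> * x\<^sup>2) * (1 + \<beta> * y\<^sup>2)"
  have d: "?d > 0" using p by simp
  have "x / (1 + \<beta> * x\<^sup>2) - y / (1 + \<beta> * y\<^sup>2) = (x - y) * ((1 - \<beta> * (x * y)) / ?d)"
    using p by (simp add: divide_simps) (simp add: algebra_simps power2_eq_square)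
  moreover have "\<bar>(1 - \<beta> * (x * y)) / ?d\<bar> \<le> 1"
  proof -
    have "2 * \<bar>x * y\<bar> \<le> x\<^sup>2 + y\<^sup>2"
      using sum_squares_bound[of "\<bar>x\<bar>" "\<bar>y\<bar>"] by (simp add: abs_mult)
    then have "\<beta> * (2 * \<bar>x * y\<bar>) \<le> \<beta> * (x\<^sup>2 + y\<^sup>2)" using assms by (rule mult_left_mono)
    moreover have "0 \<le> \<beta> * \<bar>x * y\<bar>" "0 \<le> \<beta> * x\<^sup>2 * (\<beta> * y\<^sup>2)" using assms by simp_all
    moreover have "\<bar>\<beta> * (x * y)\<bar> = \<beta> * \<bar>x * y\<bar>" using assms by (simp add: abs_mult)
    ultimately have "\<bar>1 - \<beta> * (x * y)\<bar> \<le> ?d"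
      unfolding distrib_left distrib_right by linarith
    moreover have "\<bar>(1 - \<beta> * (x * y)) / ?d\<bar> = \<bar>1 - \<beta> * (x * y)\<bar> / ?d"
      by (simp only: abs_divide abs_of_pos[OF d])
    ultimately show ?thesis using d by simp
  qed
  ultimately show ?thesis by (metis abs_ge_zero abs_mult mult_left_le)
qed

text \<open>Splitting off the linear part confines all dependence on \<open>a\<close> and
  \<open>r\<close> to the term controlled by \<open>saturated_lipschitz\<close>.\<close>

lemma react_eq:
  assumes "\<alpha> > 0"
  shows "react m \<alpha> a \<kappa> r y = 2 * \<kappa> * y - 2 / \<alpha> * (y - y / (1 + \<alpha> * (a\<^sup>2 * r ^ (2 * m)) * y\<^sup>2))"
proof -
  have "a\<^sup>2 * r ^ (2 * m) \<ge> 0" by simp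
  then obtain c where c: "c = a\<^sup>2 * r ^ (2 * m)" "c \<ge> 0" by blast
  have "1 + \<alpha> * c * y\<^sup>2 > 0" using assms c by (intro add_pos_nonneg) auto
  then have "2 * c * y ^ 3 / (1 + \<alpha> * c * y\<^sup>2) = 2 / \<alpha> * (y - y / (1 + \<alpha> * c * y\<^sup>2))"
    using assms by (simp add: divide_simps) (simp add: algebra_simps power2_eq_square power3_eq_cube)
  then show ?thesis unfolding react_def c by simp
qed

lemma react_lipschitz:
  assumes "\<alpha> > 0"
  shows "\<bar>react m \<alpha> a \<kappa> r x - react m \<alpha> a \<kappa> r y\<bar> \<le> (2 * \<bar>\<kappa>\<bar> + 4 / \<alpha>) * \<bar>x - y\<bar>"
proof -
  have b: "\<alpha> * (a\<^sup>2 * r ^ (2 * m)) \<ge> 0" using assms by simp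
  let ?s = "\<lambda>y. y / (1 + \<alpha> * (a\<^sup>2 * r ^ (2 * m)) * y\<^sup>2)"
  have "react m \<alpha> a \<kappa> r x - react m \<alpha> a \<kappa> r y =
      2 * \<kappa> * (x - y) - 2 / \<alpha> * ((x - y) - (?s x - ?s y))"
    by (simp add: react_eq[OF assms] right_diff_distrib)
  also have "\<bar>\<dots>\<bar> \<le> \<bar>2 * \<kappa> * (x - y)\<bar> + \<bar>2 / \<alpha> * ((x - y) - (?s x - ?s y))\<bar>"
    by (rule abs_triangle_ineq4)
  also have "\<bar>2 / \<alpha> * ((x - y) - (?s x - ?s y))\<bar> \<le> 2 / \<alpha> * (2 * \<bar>x - y\<bar>)"
  proof -
    have "\<bar>(x - y) - (?s x - ?s y)\<bar> \<le> 2 * \<bar>x - y\<bar>"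
      by (rule order_trans[OF abs_triangle_ineq4]) (use saturated_lipschitz[OF b, of x y] in simp)
    then show ?thesis unfolding abs_mult using assms by (intro mult_mono) auto
  qed
  finally show ?thesis unfolding abs_mult[of "2 * \<kappa>" "x - y"] abs_mult[of 2 \<kappa>] by (simp add: algebra_simps)
qed

text \<open>The linear coefficient \<open>2 * \<kappa> - 2 / \<alpha>\<close> is nonnegative from
  \<open>\<kappa> = 1 / \<alpha>\<close> on, and the saturated remainder has the sign of
  \<open>y\<close>. This fixes the upper end of the shooting range.\<close>

lemma react_nonneg:
  assumes "\<alpha> > 0" "\<kappa> \<ge> 1 / \<alpha>" "y \<ge> 0"
  shows "react m \<alpha> a \<kappa> r y \<ge> 0"
proof -
  have "1 / \<alpha> * y \<le> \<kappa> * y" using assms by (intro mult_right_mono)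
  moreover have "0 \<le> y / (1 + \<alpha> * (a\<^sup>2 * r ^ (2 * m)) * y\<^sup>2)"
    using assms by (intro divide_nonneg_nonneg add_nonneg_nonneg) auto
  then have "0 \<le> 2 / \<alpha> * (y / (1 + \<alpha> * (a\<^sup>2 * r ^ (2 * m)) * y\<^sup>2))"
    using assms by (intro mult_nonneg_nonneg) auto
  ultimately show ?thesis unfolding react_eq[OF assms(1)] right_diff_distrib by linarith
qed

lemma react_le:
  assumes "\<alpha> > 0" "y \<ge> 0"
  shows "react m \<alpha> a \<kappa> r y \<le> 2 * \<kappa> * y"
  unfolding react_def using assms by (simp add: zero_le_mult_iff)

lemma continuous_on_react:
  assumes "\<alpha> > 0" "continuous_on S f" "continuous_on S g" "continuous_on S h" "continuous_on S b"
  shows "continuous_on S (\<lambda>x. react m \<alpha> (f x) (g x) (h x) (b x))"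
  unfolding react_def using assms
  by (intro continuous_intros) (auto simp: add_pos_nonneg intro!: less_imp_neq[THEN not_sym] add_pos_nonneg)

text \<open>The substitution \<open>u = a r\<^sup>m y\<close> with \<open>y 0 = 1\<close> removes the singular term:
  \<open>(r u\<^sub>r)\<^sub>r - m\<^sup>2 u / r\<close> becomes \<open>a r\<^sup>m (r y\<^sub>r\<^sub>r + (2 m + 1) y\<^sub>r)\<close>.\<close>

locale radial_profile =
  fixes m :: nat and \<alpha> a \<kappa> :: real and y D :: "real \<Rightarrow> real"
  assumes m: "m \<ge> 1" and \<alpha>: "\<alpha> > 0"
    and cont_y: "continuous_on UNIV y" and cont_D: "continuous_on UNIV D" and y0: "y 0 = 1"
    and deriv_y: "\<And>r. r > 0 \<Longrightarrow> (y has_real_derivative D r) (at r)"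
    and deriv_D: "\<And>r. r > 0 \<Longrightarrow> (D has_real_derivative
      react m \<alpha> a \<kappa> r (y r) - real (2 * m + 1) * D r / r) (at r)"
begin

text \<open>The integrating factor absorbs the damping: the derivative of \<open>P\<close> is
  \<open>r ^ (2 * m + 1)\<close> times the reaction term, so the sign of the reaction controls
  \<open>P\<close>, hence \<open>D\<close>, hence the monotonicity of \<open>y\<close>.\<close>

definition P :: "real \<Rightarrow> real" where "P r = r ^ (2 * m + 1) * D r"

lemma P_0: "P 0 = 0" by (simp add: P_def)

lemma cont_P: "continuous_on S P"
  unfolding P_def by (intro continuous_intros continuous_on_subset[OF cont_D]) auto

lemma deriv_P: "r > 0 \<Longrightarrow> (P has_real_derivative r ^ (2 * m + 1) * react m \<alpha> a \<kappa> r (y r)) (at r)"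
  unfolding P_def
  by (rule derivative_eq_intros deriv_D refl | assumption)+ (auto simp: field_simps)

lemma P_sign:
  assumes "r > 0"
  shows "0 \<le> P r \<longleftrightarrow> 0 \<le> D r" "P r \<le> 0 \<longleftrightarrow> D r \<le> 0"
proof -
  have "r ^ (2 * m + 1) > 0" using assms by (rule zero_less_power)
  then show "0 \<le> P r \<longleftrightarrow> 0 \<le> D r" "P r \<le> 0 \<longleftrightarrow> D r \<le> 0"
    unfolding P_def zero_le_mult_iff mult_le_0_iff by linarith+
qed

lemma mono_y:
  assumes "0 \<le> s" "s \<le> t" "\<And>r. s < r \<Longrightarrow> r < t \<Longrightarrow> P r \<ge> 0"
  shows "y s \<le> y t"
proof (rule DERIV_nonneg_imp_increasing_open[OF \<open>s \<le> t\<close>])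
  fix r assume r: "s < r" "r < t"
  then have "D r \<ge> 0" using assms(1) assms(3)[OF r] P_sign[of r] by simp
  then show "\<exists>z. (y has_real_derivative z) (at r) \<and> 0 \<le> z"
    using deriv_y[of r] r assms(1) by auto
qed (rule continuous_on_subset[OF cont_y], simp)

text \<open>Before the first nonpositive point \<open>z\<close> the reaction is nonnegative, so
  \<open>P\<close> grows from \<open>0\<close> and \<open>y\<close> grows from \<open>1\<close>;
  then \<open>y z\<close> cannot be nonpositive.\<close>

lemma pos_if_large_kappa:
  assumes "\<kappa> \<ge> 1 / \<alpha>" "b \<ge> 0"
  shows "y b > 0"
proof (rule ccontr)
  assume nb: "\<not> y b > 0"
  define Z where "Z = {r \<in> {0..b}. y r \<le> 0}"
  have "closed Z" unfolding Z_def
    using continuous_closed_preimage[OF continuous_on_subset[OF cont_y], of "{0..b}" "{..0}"]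
    by (simp add: vimage_def Int_def)
  then have "compact Z" by (auto simp: compact_eq_bounded_closed Z_def intro: bounded_subset[of "{0..b}"])
  moreover have "b \<in> Z" using nb assms by (simp add: Z_def)
  ultimately obtain z where z: "z \<in> Z" "\<And>t. t \<in> Z \<Longrightarrow> z \<le> t"
    using compact_attains_inf[of Z] by blast
  have pos: "y r > 0" if "0 \<le> r" "r < z" for r
    using z(2)[of r] z(1) that by (force simp: Z_def)
  have "P r \<ge> 0" if r: "0 < r" "r < z" for r
  proof -
    have "P 0 \<le> P r"
    proof (rule DERIV_nonneg_imp_increasing_open[of 0 r P])
      fix s assume s: "0 < s" "s < r"
      then show "\<exists>z. (P has_real_derivative z) (at s) \<and> 0 \<le> z"
        using deriv_P[of s] react_nonneg[OF \<alpha> assms(1), of "y s"] pos[of s] r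
        by (intro exI[of _ "s ^ (2 * m + 1) * react m \<alpha> a \<kappa> s (y s)"]) auto
    qed (use r in \<open>auto intro!: cont_P\<close>)
    then show ?thesis by (simp add: P_0)
  qed
  then have "y 0 \<le> y z" using z(1) by (intro mono_y) (auto simp: Z_def)
  then show False using z(1) y0 by (simp add: Z_def)
qed

text \<open>The threshold for \<open>- \<kappa>\<close> makes the decrease of a positive \<open>y\<close> over \<open>[R / 2, R]\<close> exceed \<open>y (R / 2)\<close>.\<close>

lemma has_nonpos_value:
  assumes R: "R > 0" and \<kappa>: "\<kappa> \<le> 0"
    and big: "- \<kappa> * (R / 2) ^ (2 * m + 2) * R \<ge> real (2 * m + 2) * R ^ (2 * m + 1)"
  shows "\<exists>r\<in>{0..R}. y r \<le> 0"
proof (rule ccontr)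
  assume "\<not> ?thesis"
  then have pos: "y r > 0" if "0 \<le> r" "r \<le> R" for r using that by force
  let ?k = "2 * m + 1"
  have neg: "react m \<alpha> a \<kappa> r (y r) \<le> 0" if "0 < r" "r \<le> R" for r
  proof -
    have "2 * \<kappa> * y r \<le> 0" using \<kappa> pos[of r] that by (simp add: mult_nonpos_nonneg)
    with react_le[OF \<alpha>, of "y r" m a \<kappa> r] pos[of r] that show ?thesis by linarith
  qed
  have P_anti: "P t \<le> P s" if "0 \<le> s" "s \<le> t" "t \<le> R" for s t
  proof (rule DERIV_nonpos_imp_decreasing_open[OF \<open>s \<le> t\<close>])
    fix r assume r: "s < r" "r < t"
    then show "\<exists>z. (P has_real_derivative z) (at r) \<and> z \<le> 0"
      using deriv_P[of r] neg[of r] that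
      by (intro exI[of _ "r ^ ?k * react m \<alpha> a \<kappa> r (y r)"]) (auto simp: mult_nonneg_nonpos)
  qed (rule cont_P)
  have y_anti: "y t \<le> y s" if "0 \<le> s" "s \<le> t" "t \<le> R" for s t
  proof (rule DERIV_nonpos_imp_decreasing_open[OF \<open>s \<le> t\<close>])
    fix r assume r: "s < r" "r < t"
    have "P r \<le> 0" using P_anti[of 0 r] r that by (simp add: P_0)
    then have "D r \<le> 0" using r that P_sign[of r] by simp
    then show "\<exists>z. (y has_real_derivative z) (at r) \<and> z \<le> 0"
      using deriv_y[of r] r that by auto
  qed (rule continuous_on_subset[OF cont_y], simp)
  define c where "c = y (R / 2)"
  have c: "c > 0" using pos[of "R / 2"] R by (simp add: c_def)
  \<comment> \<open>\<open>b\<close> is the integral of \<open>r ^ (2 * m + 1)\<close> over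
    \<open>{0..R / 2}\<close>. As \<open>y\<close> is at least \<open>c\<close> there, comparing
    derivatives gives \<open>P (R / 2) \<le> 2 * \<kappa> * c * b\<close>.\<close>
  define b where "b = (R / 2) ^ (2 * m + 2) / real (2 * m + 2)"
  let ?Q = "\<lambda>r. P r - 2 * \<kappa> * c * (r ^ (2 * m + 2) / real (2 * m + 2))"
  have "?Q (R / 2) \<le> ?Q 0"
  proof (rule DERIV_nonpos_imp_decreasing_open[of 0 "R / 2" ?Q])
    fix r assume r: "0 < r" "r < R / 2"
    have "((\<lambda>r::real. r ^ (2 * m + 2) / real (2 * m + 2)) has_real_derivative
        (real (2 * m + 2) * r ^ (2 * m + 2 - Suc 0)) / real (2 * m + 2)) (at r)"
      by (intro DERIV_cdivide DERIV_pow)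
    then have *: "((\<lambda>r::real. r ^ (2 * m + 2) / real (2 * m + 2)) has_real_derivative r ^ ?k) (at r)"
      by simp
    have "(?Q has_real_derivative r ^ ?k * react m \<alpha> a \<kappa> r (y r) - 2 * \<kappa> * c * r ^ ?k) (at r)"
      by (intro DERIV_diff DERIV_cmult deriv_P * r)
    moreover have "r ^ ?k * react m \<alpha> a \<kappa> r (y r) \<le> r ^ ?k * (2 * \<kappa> * c)"
    proof (rule mult_left_mono)
      have "c \<le> y r" using y_anti[of r "R / 2"] r R by (simp add: c_def)
      then have "2 * \<kappa> * y r \<le> 2 * \<kappa> * c" using \<kappa> by (simp add: mult_left_mono_neg)
      with react_le[OF \<alpha>, of "y r" m a \<kappa> r] pos[of r] r R
      show "react m \<alpha> a \<kappa> r (y r) \<le> 2 * \<kappa> * c" by simp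
    qed (use r in simp)
    ultimately show "\<exists>z. (?Q has_real_derivative z) (at r) \<and> z \<le> 0"
      by (intro exI conjI) (auto simp: mult.commute)
  qed (use R in \<open>auto intro!: continuous_intros cont_P\<close>)
  then have PR: "P (R / 2) \<le> 2 * \<kappa> * c * b" by (simp add: P_0 b_def)
  \<comment> \<open>\<open>K\<close> bounds the slope on \<open>[R / 2, R]\<close> from above:
    \<open>P\<close> stays below the negative or zero value \<open>2 * \<kappa> * c * b\<close>, and
    dividing by the largest power \<open>R ^ (2 * m + 1)\<close> gives the weakest bound.\<close>
  define K where "K = 2 * \<kappa> * c * b / R ^ ?k"
  have b0: "b \<ge> 0" using R by (simp add: b_def)
  have cb: "2 * \<kappa> * c * b \<le> 0" using \<kappa> c b0 by (simp add: mult_nonpos_nonneg)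
  let ?Y = "\<lambda>r. y r - K * r"
  have "?Y R \<le> ?Y (R / 2)"
  proof (rule DERIV_nonpos_imp_decreasing_open[of "R / 2" R ?Y])
    fix r assume r: "R / 2 < r" "r < R"
    have "P r \<le> 2 * \<kappa> * c * b" using P_anti[of "R / 2" r] PR r R by simp
    then have "D r \<le> 2 * \<kappa> * c * b / r ^ ?k" using r R by (simp add: P_def field_simps)
    also have "\<dots> \<le> K" unfolding K_def using cb r R by (intro divide_left_mono_neg power_mono) auto
    finally show "\<exists>z. (?Y has_real_derivative z) (at r) \<and> z \<le> 0"
      using r R by (intro exI[of _ "D r - K"]) (auto intro!: derivative_eq_intros deriv_y)
  qed (use R in \<open>auto intro!: continuous_intros continuous_on_subset[OF cont_y]\<close>)
  then have "y R \<le> c + K * (R / 2)" by (simp add: c_def algebra_simps)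
  also have "\<dots> = c * (1 + \<kappa> * b * R / R ^ ?k)" by (simp add: K_def field_simps)
  also have "\<dots> \<le> 0"
  proof -
    have "R ^ ?k > 0" using R by (rule zero_less_power)
    then have p: "real (2 * m + 2) * R ^ ?k > 0" by simp
    have "\<kappa> * b * R / R ^ ?k = \<kappa> * (R / 2) ^ (2 * m + 2) * R / (real (2 * m + 2) * R ^ ?k)"
      by (simp only: b_def times_divide_eq_left times_divide_eq_right divide_divide_eq_left)
    also have "\<dots> \<le> -1" unfolding pos_divide_le_eq[OF p] using big by linarith
    finally have "\<kappa> * b * R / R ^ ?k \<le> -1" .
    then show ?thesis using c by (intro mult_nonneg_nonpos) auto
  qed
  finally show False using pos[of R] R by simp
qed

text \<open>Backward Gronwall estimate for \<open>y\<^sup>2 + D\<^sup>2\<close>, away from the singular point: a double zero would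
  force \<open>y\<close> to vanish down to \<open>0\<close>, where \<open>y\<close> is \<open>1\<close>.\<close>

lemma no_double_zero:
  assumes "r0 > 0" "y r0 = 0"
  shows "D r0 \<noteq> 0"
proof
  assume D0: "D r0 = 0"
  define M where "M = 2 * \<bar>\<kappa>\<bar> + 4 / \<alpha>"
  have "y d = 0" if d: "0 < d" "d < r0" for d
  proof -
    \<comment> \<open>\<open>C\<close> collects the losses in the derivative of
      \<open>y\<^sup>2 + D\<^sup>2\<close>: one unit each from \<open>2 y D\<close> and
      \<open>2 D g\<close>, \<open>M\<^sup>2\<close> from \<open>g\<^sup>2\<close>, and the damping,
      which is bounded because \<open>r > d\<close>. The weight \<open>exp (C * r)\<close> then
      makes the sum nondecreasing.\<close>
    define C where "C = 2 + M\<^sup>2 + 2 * real (2 * m + 1) / d"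
    let ?E = "\<lambda>r. exp (C * r) * ((y r)\<^sup>2 + (D r)\<^sup>2)"
    have "?E d \<le> ?E r0"
    proof (rule DERIV_nonneg_imp_increasing_open[of d r0 ?E])
      fix r assume r: "d < r" "r < r0"
      define g where "g = react m \<alpha> a \<kappa> r (y r)"
      let ?e = "C * exp (C * r) * ((y r)\<^sup>2 + (D r)\<^sup>2)
        + exp (C * r) * (2 * y r * D r + 2 * D r * (g - real (2 * m + 1) * D r / r))"
      have "(?E has_real_derivative ?e) (at r)"
        unfolding g_def using r d
        by (auto intro!: derivative_eq_intros deriv_y deriv_D)
      moreover have "?e \<ge> 0"
      proof -
        have "\<bar>g\<bar> \<le> M * \<bar>y r\<bar>"
          using react_lipschitz[OF \<alpha>, of m a \<kappa> r "y r" 0] by (simp add: g_def M_def react_def)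
        then have "g\<^sup>2 \<le> (M * \<bar>y r\<bar>)\<^sup>2" by (metis abs_ge_zero power2_abs power_mono)
        then have 1: "g\<^sup>2 \<le> M\<^sup>2 * (y r)\<^sup>2" by (simp add: power_mult_distrib)
        have 2: "- (g\<^sup>2 + (D r)\<^sup>2) \<le> 2 * D r * g"
          using zero_le_power2[of "D r + g"] by (simp add: power2_sum algebra_simps)
        have 3: "- ((y r)\<^sup>2 + (D r)\<^sup>2) \<le> 2 * y r * D r"
          using zero_le_power2[of "y r + D r"] by (simp add: power2_sum algebra_simps)
        have 4: "real (2 * m + 1) / r * (D r)\<^sup>2 \<le> real (2 * m + 1) / d * (D r)\<^sup>2"
          using r d by (intro mult_right_mono divide_left_mono) auto
        have 5: "0 \<le> M\<^sup>2 * (D r)\<^sup>2" "0 \<le> real (2 * m + 1) / d * (y r)\<^sup>2" using d by auto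
        have "0 \<le> C * ((y r)\<^sup>2 + (D r)\<^sup>2) + (2 * y r * D r + 2 * D r * g - 2 * (real (2 * m + 1) / r * (D r)\<^sup>2))"
          using 1 2 3 4 5 zero_le_power2[of "y r"]
          unfolding C_def by (simp only: distrib_left distrib_right times_divide_eq_right[symmetric])
        then have "0 \<le> exp (C * r) * (C * ((y r)\<^sup>2 + (D r)\<^sup>2) + (2 * y r * D r + 2 * D r * g - 2 * (real (2 * m + 1) / r * (D r)\<^sup>2)))"
          by simp
        also have "\<dots> = ?e" by (simp add: algebra_simps power2_eq_square)
        finally show ?thesis .
      qed
      ultimately show "\<exists>z. (?E has_real_derivative z) (at r) \<and> 0 \<le> z" by blast
    qed (use d in \<open>auto intro!: continuous_intros continuous_on_subset[OF cont_y] continuous_on_subset[OF cont_D]\<close>)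
    then have "(y d)\<^sup>2 + (D d)\<^sup>2 \<le> 0" using assms D0 by (simp add: mult_le_0_iff)
    then show ?thesis by (simp add: sum_power2_le_zero_iff)
  qed
  then have "\<forall>\<^sub>F d in at_right 0. y d = 0"
    using \<open>r0 > 0\<close> by (auto simp: eventually_at_right_field intro!: exI[of _ r0])
  then have "(y \<longlongrightarrow> 0) (at_right 0)" by (simp add: tendsto_eventually)
  moreover have "(y \<longlongrightarrow> y 0) (at_right 0)"
    using cont_y by (auto simp: continuous_on_def intro: tendsto_within_subset)
  ultimately show False
    using tendsto_unique[of "at_right (0::real)" y 0 "y 0"] y0 by simp
qed

section \<open>From the profile back to the vortex\<close>

definition u :: "real \<Rightarrow> real" where "u r = a * r ^ m * y r"

lemma deriv_u:
  assumes "r > 0"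
  shows "(u has_real_derivative a * (real m * r ^ (m - 1) * y r + r ^ m * D r)) (at r)"
  unfolding u_def using assms
  by (auto intro!: derivative_eq_intros deriv_y simp: algebra_simps)

text \<open>The terms in \<open>D\<close> cancel since \<open>m + (m + 1) = 2 m + 1\<close>, and the
  remaining \<open>m\<^sup>2 r ^ (m - 1) y\<close> is the singular term
  \<open>n\<^sup>2 u / r\<close> up to the factor \<open>a\<close>.\<close>

lemma vortex_solution_u:
  assumes "y R = 0" "real_of_int n ^ 2 = real m ^ 2"
  shows "vortex_solution n \<alpha> R \<kappa> u"
  unfolding vortex_solution_def
proof (intro conjI ballI)
  show "continuous_on {0..R} u"
    unfolding u_def by (intro continuous_intros continuous_on_subset[OF cont_y]) auto
  show "u 0 = 0" "u R = 0" using m assms by (auto simp: u_def)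
  fix r assume "r \<in> {0<..<R}"
  then have r: "r > 0" by simp
  show "u differentiable at r"
    using deriv_u[OF r] by (auto simp: real_differentiable_def)
  obtain j where j: "m = Suc j" using m by (cases m) auto
  define g where "g = react m \<alpha> a \<kappa> r (y r)"
  \<comment> \<open>This is \<open>r u'\<close> with the power of \<open>r\<close> multiplied in,
    which avoids the exponent \<open>m - 1\<close> before differentiating.\<close>
  let ?w = "\<lambda>r. a * (real m * r ^ m * y r + r ^ (m + 1) * D r)"
  have "(?w has_real_derivative a * (real m * (real m * r ^ (m - 1) * y r + r ^ m * D r)
     + (real (m + 1) * r ^ m * D r + r ^ (m + 1) * (g - real (2 * m + 1) * D r / r)))) (at r)"
    unfolding g_def
    by (rule DERIV_cong[OF DERIV_cmult[OF DERIV_add[OF DERIV_mult[OF DERIV_cmult[OF DERIV_pow] deriv_y[OF r]]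
        DERIV_mult[OF DERIV_pow deriv_D[OF r]]]]]) (simp add: algebra_simps)
  moreover have "a * (real m * (real m * r ^ (m - 1) * y r + r ^ m * D r)
     + (real (m + 1) * r ^ m * D r + r ^ (m + 1) * (g - real (2 * m + 1) * D r / r)))
     = (real_of_int n)\<^sup>2 / r * u r - 2 * r * (u r) ^ 3 / (1 + \<alpha> * (u r)\<^sup>2) + 2 * \<kappa> * r * u r"
  proof -
    have "r ^ (m + 1) * (real (2 * m + 1) * D r / r) = real (2 * m + 1) * r ^ m * D r"
      using r by simp
    moreover have "(real_of_int n)\<^sup>2 / r * u r = a * (real m * real m * r ^ (m - 1) * y r)"
      using r assms(2) unfolding u_def by (simp add: j power2_eq_square)
    moreover have "a * r ^ (m + 1) * g = - 2 * r * (u r) ^ 3 / (1 + \<alpha> * (u r)\<^sup>2) + 2 * \<kappa> * r * u r"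
    proof -
      have "(u r)\<^sup>2 = a\<^sup>2 * r ^ (2 * m) * (y r)\<^sup>2"
        by (simp add: u_def power_mult_distrib power_mult mult.commute[of 2])
      moreover have "(u r) ^ 3 = a * r ^ m * (a\<^sup>2 * r ^ (2 * m)) * (y r) ^ 3"
        by (simp add: u_def power_mult_distrib power_mult mult.commute[of 2] power2_eq_square power3_eq_cube)
      ultimately show ?thesis
        by (simp add: g_def react_def u_def right_diff_distrib mult_ac)
    qed
    ultimately show ?thesis by (simp add: algebra_simps)
  qed
  ultimately have *: "(?w has_real_derivative (real_of_int n)\<^sup>2 / r * u r
     - 2 * r * (u r) ^ 3 / (1 + \<alpha> * (u r)\<^sup>2) + 2 * \<kappa> * r * u r) (at r)" by simp
  have eq: "s * deriv u s = ?w s" if "s > 0" for s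
    using DERIV_imp_deriv[OF deriv_u[OF that]] m by (cases m) (auto simp: algebra_simps)
  show "((\<lambda>s. s * deriv u s) has_real_derivative (real_of_int n)\<^sup>2 / r * u r
     - 2 * r * (u r) ^ 3 / (1 + \<alpha> * (u r)\<^sup>2) + 2 * \<kappa> * r * u r) (at r)"
    by (rule iffD2[OF has_field_derivative_cong_ev[OF refl _ refl] *])
      (use r in \<open>auto intro!: eventually_mono[OF eventually_nhds_in_open[of "{0<..}" r]] simp: eq simp del: power_Suc\<close>)
qed

text \<open>The only singular term is
  \<open>u\<^sup>2 / r = a\<^sup>2 r ^ (2 m - 1) y\<^sup>2\<close>, whose exponent is at least
  \<open>1\<close>; the energy density thus agrees with a function continuous on
  \<open>{0..R}\<close>.\<close>

lemma finite_energy_u: "finite_energy \<alpha> R u"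
  unfolding finite_energy_def
proof -
  let ?f = "\<lambda>r. r * (a * (real m * r ^ (m - 1) * y r + r ^ m * D r))\<^sup>2
    + a\<^sup>2 * r ^ (2 * m - 1) * (y r)\<^sup>2 + r * ln (1 + \<alpha> * (a * r ^ m * y r)\<^sup>2)"
  have "continuous_on {0..R} ?f"
    using \<alpha> by (intro continuous_intros continuous_on_subset[OF cont_y] continuous_on_subset[OF cont_D])
      (auto intro!: less_imp_neq[THEN not_sym] add_pos_nonneg)
  then have "set_integrable lborel {0..R} ?f" by (rule borel_integrable_atLeastAtMost')
  then have "set_integrable lborel {0<..<R} ?f" by (rule set_integrable_subset) auto
  also have "?this \<longleftrightarrow> set_integrable lborel {0<..<R} (energy_density \<alpha> u)"
  proof (rule set_integrable_cong)
    fix r assume "r \<in> {0<..<R}"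
    then have r: "r > 0" by simp
    have "(u r)\<^sup>2 = a\<^sup>2 * (r ^ m * r ^ m) * (y r)\<^sup>2"
      by (simp add: u_def power2_eq_square)
    moreover have "r ^ m * r ^ m = r ^ (2 * m - 1) * r"
      using m by (simp add: power_add[symmetric] mult_2[symmetric] power_Suc2[symmetric] del: power_Suc)
    ultimately have "(u r)\<^sup>2 / r = a\<^sup>2 * r ^ (2 * m - 1) * (y r)\<^sup>2"
      using r by simp
    then show "?f r = energy_density \<alpha> u r"
      by (simp add: energy_density_def DERIV_imp_deriv[OF deriv_u[OF r]] u_def)
  qed auto
  finally show "set_integrable lborel {0<..<R} (energy_density \<alpha> u)" .
qed

lemma flux_u: "flux R u = 2 * pi * a\<^sup>2 * integral {0..R} (\<lambda>r. r ^ (2 * m + 1) * (y r)\<^sup>2)"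
proof -
  have "continuous_on {0..R} (\<lambda>r. r * (u r)\<^sup>2)"
    unfolding u_def by (intro continuous_intros continuous_on_subset[OF cont_y]) auto
  then have "(\<integral>r\<in>{0..R}. r * (u r)\<^sup>2 \<partial>lborel) = integral {0..R} (\<lambda>r. r * (u r)\<^sup>2)"
    by (intro set_borel_integral_eq_integral borel_integrable_atLeastAtMost')
  also have "\<dots> = integral {0..R} (\<lambda>r. a\<^sup>2 * (r ^ (2 * m + 1) * (y r)\<^sup>2))"
    by (simp add: u_def power_mult_distrib power_mult mult.commute[of 2] mult_ac)
  finally show ?thesis by (simp add: flux_def)
qed

end

section \<open>Shooting\<close>

text \<open>Brouwer's theorem gives a fixed point of \<open>x - (f, g)\<close> clamped to the
  rectangle. If a component were negative there, the point would lie on the upper side, where that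
  component is nonnegative; symmetrically for positive.\<close>

lemma poincare_miranda_plane:
  fixes f g :: "real \<times> real \<Rightarrow> real"
  assumes ab: "a0 \<le> a1" "k0 \<le> k1"
    and cf: "continuous_on ({a0..a1} \<times> {k0..k1}) f" and cg: "continuous_on ({a0..a1} \<times> {k0..k1}) g"
    and f: "\<And>k. k \<in> {k0..k1} \<Longrightarrow> f (a0, k) \<le> 0" "\<And>k. k \<in> {k0..k1} \<Longrightarrow> f (a1, k) \<ge> 0"
    and g: "\<And>a. a \<in> {a0..a1} \<Longrightarrow> g (a, k0) \<le> 0" "\<And>a. a \<in> {a0..a1} \<Longrightarrow> g (a, k1) \<ge> 0"
  obtains a k where "a \<in> {a0..a1}" "k \<in> {k0..k1}" "f (a, k) = 0" "g (a, k) = 0"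
proof -
  let ?S = "{a0..a1} \<times> {k0..k1}"
  let ?T = "\<lambda>x. (max a0 (min a1 (fst x - f x)), max k0 (min k1 (snd x - g x)))"
  have "continuous_on ?S ?T" by (intro continuous_intros cf cg)
  moreover have "?T \<in> ?S \<rightarrow> ?S" using ab by auto
  moreover have "compact ?S" "convex ?S" "?S \<noteq> {}" using ab by (auto intro: compact_Times convex_Times)
  ultimately obtain x where x: "x \<in> ?S" "?T x = x" using brouwer[of ?S ?T] by blast
  obtain a k where ak: "x = (a, k)" by (cases x)
  have a: "max a0 (min a1 (a - f (a, k))) = a" "a \<in> {a0..a1}" "k \<in> {k0..k1}"
    and k: "max k0 (min k1 (k - g (a, k))) = k" using x ak by auto
  have "f (a, k) = 0"
  proof (rule linorder_cases[of "f (a, k)" 0])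
    assume n: "f (a, k) < 0"
    then have "a = a1" using a by auto
    then show ?thesis using f(2)[of k] a n by simp
  next
    assume n: "0 < f (a, k)"
    then have "a = a0" using a by auto
    then show ?thesis using f(1)[of k] a n by simp
  qed
  moreover have "g (a, k) = 0"
  proof (rule linorder_cases[of "g (a, k)" 0])
    assume n: "g (a, k) < 0"
    then have "k = k1" using a k by auto
    then show ?thesis using g(2)[of a] a n by simp
  next
    assume n: "0 < g (a, k)"
    then have "k = k0" using a k by auto
    then show ?thesis using g(1)[of a] a n by simp
  qed
  ultimately show ?thesis using that a by blast
qed

text \<open>Uniform continuity on the compact product moves all values \<open>f (p, t)\<close> by
  less than \<open>e / 2\<close> at once, hence also their infimum. It serves to make the minimum of
  the profile continuous in the parameters.\<close>

lemma continuous_on_INF_compact: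
  fixes f :: "'a::metric_space \<times> 'b::metric_space \<Rightarrow> real"
  assumes S: "compact S" and T: "compact T" "T \<noteq> {}" and f: "continuous_on (S \<times> T) f"
  shows "continuous_on S (\<lambda>p. INF t\<in>T. f (p, t))"
  unfolding continuous_on_iff
proof (intro ballI allI impI)
  fix p and e :: real assume p: "p \<in> S" and e: "e > 0"
  have bdd: "bdd_below ((\<lambda>t. f (q, t)) ` T)" if "q \<in> S" for q
  proof -
    have "continuous_on T (\<lambda>t. f (q, t))"
      using that by (intro continuous_on_compose2[OF f] continuous_intros) auto
    then show ?thesis by (intro bounded_imp_bdd_below compact_imp_bounded compact_continuous_image T)
  qed
  have "uniformly_continuous_on (S \<times> T) f"
    by (intro compact_uniformly_continuous f compact_Times S T)
  then obtain d where d: "d > 0" "\<And>x y. x \<in> S \<times> T \<Longrightarrow> y \<in> S \<times> T \<Longrightarrow> dist y x < d \<Longrightarrow> dist (f y) (f x) < e / 2"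
    unfolding uniformly_continuous_on_def using e by (metis half_gt_zero)
  have le: "(INF t\<in>T. f (q, t)) - e / 2 \<le> (INF t\<in>T. f (q', t))"
    if "q \<in> S" "q' \<in> S" "dist q' q < d" for q q'
  proof (rule cINF_greatest[OF T(2)])
    fix t assume t: "t \<in> T"
    have "(INF t\<in>T. f (q, t)) \<le> f (q, t)" using t that by (intro cINF_lower bdd)
    moreover have "dist (f (q', t)) (f (q, t)) < e / 2" using t that by (intro d(2)) (auto simp: dist_Pair_Pair)
    ultimately show "(INF t\<in>T. f (q, t)) - e / 2 \<le> f (q', t)" unfolding dist_real_def by linarith
  qed
  show "\<exists>d>0. \<forall>x'\<in>S. dist x' p < d \<longrightarrow> dist (INF t\<in>T. f (x', t)) (INF t\<in>T. f (p, t)) < e"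
  proof (intro exI[of _ d] conjI ballI impI d(1))
    fix q assume q: "q \<in> S" "dist q p < d"
    then show "dist (INF t\<in>T. f (q, t)) (INF t\<in>T. f (p, t)) < e"
      using le[of p q] le[of q p] p e by (simp add: dist_real_def abs_less_iff dist_commute)
  qed
qed

section \<open>Existence by shooting in amplitude and \<kappa>\<close>

lemma exists_positive_vortex:
  fixes n :: int and \<alpha> R Q0 :: real
  assumes n: "\<bar>n\<bar> \<ge> 1" and \<alpha>: "\<alpha> > 0" and R: "R > 0" and Q0: "Q0 > 0"
  obtains u \<kappa> where "vortex_solution n \<alpha> R \<kappa> u" "finite_energy \<alpha> R u" "flux R u = Q0"
    "\<And>r. r \<in> {0<..<R} \<Longrightarrow> u r > 0"
proof -
  define m where "m = nat \<bar>n\<bar>"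
  have m: "m \<ge> 1" "real_of_int n ^ 2 = real m ^ 2" using n by (auto simp: m_def)
  let ?k = "2 * m + 1"
  \<comment> \<open>Equality in the threshold of \<open>has_nonpos_value\<close>.\<close>
  define \<kappa>0 where "\<kappa>0 = - (real (2 * m + 2) * R ^ ?k / ((R / 2) ^ (2 * m + 2) * R))"
  define \<kappa>1 where "\<kappa>1 = 1 / \<alpha>"
  have \<kappa>0: "\<kappa>0 \<le> 0" using R by (simp add: \<kappa>0_def)
  have big: "- \<kappa>0 * (R / 2) ^ (2 * m + 2) * R \<ge> real (2 * m + 2) * R ^ ?k"
    using R by (simp add: \<kappa>0_def)
  have \<kappa>1: "\<kappa>1 > 0" using \<alpha> by (simp add: \<kappa>1_def)
  \<comment> \<open>Clamping \<open>\<kappa>\<close> makes the Lipschitz constant uniform over the parameter plane.\<close>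
  define K where "K \<kappa> = max \<kappa>0 (min \<kappa>1 \<kappa>)" for \<kappa>
  have K: "\<bar>K \<kappa>\<bar> \<le> \<kappa>1 - \<kappa>0" for \<kappa> using \<kappa>0 \<kappa>1 by (auto simp: K_def)
  have K_id: "K \<kappa> = \<kappa>" if "\<kappa> \<in> {\<kappa>0..\<kappa>1}" for \<kappa> using that by (auto simp: K_def)
  define G :: "(real \<times> real) \<times> real \<Rightarrow> real \<Rightarrow> real"
    where "G x y = react m \<alpha> (fst (fst x)) (K (snd (fst x))) (snd x) y" for x y
  define L where "L = 2 * (\<kappa>1 - \<kappa>0) + 4 / \<alpha>"
  have L: "L > 0" using \<kappa>0 \<kappa>1 \<alpha> by (simp add: L_def add_pos_pos)
  have contG: "continuous_on UNIV (\<lambda>(x, y). G x y)"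
    unfolding G_def K_def case_prod_unfold by (intro continuous_on_react \<alpha> continuous_intros)
  have lipG: "\<bar>G x y - G x z\<bar> \<le> L * \<bar>y - z\<bar>" for x y z
  proof -
    have "\<bar>G x y - G x z\<bar> \<le> (2 * \<bar>K (snd (fst x))\<bar> + 4 / \<alpha>) * \<bar>y - z\<bar>"
      unfolding G_def by (rule react_lipschitz[OF \<alpha>])
    also have "\<dots> \<le> L * \<bar>y - z\<bar>"
      using K[of "snd (fst x)"] by (intro mult_right_mono) (auto simp: L_def)
    finally show ?thesis .
  qed
  have G0: "G x 0 = 0" for x by (simp add: G_def react_def)
  obtain w M where w: "continuous_on UNIV w" "\<And>x. \<bar>w x\<bar> \<le> M * exp (L * (snd x)\<^sup>2)"
    "\<And>x. w x = 1 + shoot ?k (\<lambda>z. G z (w z)) x"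
    using picard_family[OF contG L lipG G0] by metis
  define h where "h z = G z (w z)" for z
  have h: "continuous_on UNIV h" unfolding h_def
    using continuous_on_compose2[OF contG, of UNIV "\<lambda>z. (z, w z)"] w(1)
    by (simp add: continuous_on_Pair continuous_on_id)
  have w_eq: "w x = 1 + shoot ?k h x" for x using w(3)[of x] by (simp add: h_def[abs_def])
  let ?D = "\<lambda>p r. shoot_deriv ?k h (p, r)"
  have c: "continuous_on UNIV (\<lambda>r. w (p, r))" for p
    by (intro continuous_on_compose2[OF w(1)] continuous_intros) auto
  have prof: "radial_profile m \<alpha> (fst p) (K (snd p)) (\<lambda>r. w (p, r)) (?D p)" for p
  proof
    show "continuous_on UNIV (?D p)"
      by (intro continuous_on_compose2[OF continuous_on_shoot_deriv[OF h]] continuous_intros) auto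
    show "w (p, 0) = 1" by (simp add: w_eq shoot_def)
    fix r :: real assume r: "r > 0"
    show "((\<lambda>r. w (p, r)) has_real_derivative ?D p r) (at r)"
      unfolding w_eq by (rule DERIV_cong[OF DERIV_add[OF DERIV_const shoot_has_derivative[OF h r]]]) simp
    show "(?D p has_real_derivative react m \<alpha> (fst p) (K (snd p)) r (w (p, r)) - real ?k * ?D p r / r) (at r)"
      using shoot_deriv_has_derivative[OF h r, of ?k p] by (simp add: h_def G_def)
  qed (use m \<alpha> c in auto)
  note w0 = radial_profile.y0[OF prof]

  \<comment> \<open>A slope bound on \<open>[0, R]\<close> common to all parameters, from comparing
    \<open>h\<close> with \<open>0\<close> and
    \<open>\<bar>h x\<bar> \<le> L * \<bar>w x\<bar>\<close>.\<close>
  define C where "C = R * (L * M * exp (L * R\<^sup>2))"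
  have M: "M \<ge> 0" using w(2)[of "((0,0),0)"] by simp
  have C: "C \<ge> 0" using R L M by (simp add: C_def)
  have D_le: "\<bar>?D p t\<bar> \<le> C" if t: "0 \<le> t" "t \<le> R" for p t
  proof -
    have "\<bar>?D p t - shoot_deriv ?k (\<lambda>_. 0) (p, t)\<bar> \<le> \<bar>t\<bar> * (L * M * exp (L * t\<^sup>2))"
    proof (rule shoot_deriv_diff_le[OF h _ L])
      fix x :: "(real \<times> real) \<times> real"
      have "\<bar>h x\<bar> \<le> L * \<bar>w x\<bar>" using lipG[of x "w x" 0] by (simp add: h_def G0)
      also have "\<dots> \<le> L * (M * exp (L * (snd x)\<^sup>2))" using w(2)[of x] L by (intro mult_left_mono) auto
      finally show "\<bar>h x - 0\<bar> \<le> L * M * exp (L * (snd x)\<^sup>2)" by (simp add: mult.assoc)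
    qed simp
    also have "\<dots> \<le> C"
      unfolding C_def using t L M by (intro mult_mono) (auto intro!: power_mono)
    finally show ?thesis by (simp add: shoot_deriv_def)
  qed
  have w_ge: "w (p, r) \<ge> 1 - C * r" if r: "0 \<le> r" "r \<le> R" for p r
  proof -
    have "w (p, 0) + C * 0 \<le> w (p, r) + C * r"
    proof (rule DERIV_nonneg_imp_increasing_open[of 0 r "\<lambda>r. w (p, r) + C * r"])
      fix s assume s: "0 < s" "s < r"
      have "((\<lambda>r. w (p, r) + C * r) has_real_derivative ?D p s + C) (at s)"
        using s by (auto intro!: derivative_eq_intros radial_profile.deriv_y[OF prof])
      moreover have "?D p s + C \<ge> 0" using D_le[of s p] s r by simp
      ultimately show "\<exists>z. ((\<lambda>r. w (p, r) + C * r) has_real_derivative z) (at s) \<and> 0 \<le> z" by blast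
    qed (use r in \<open>auto intro!: continuous_intros continuous_on_subset[OF c]\<close>)
    then show ?thesis by (simp add: w0)
  qed

  define I where "I p = integral {0..R} (\<lambda>r. r ^ ?k * (w (p, r))\<^sup>2)" for p
  \<comment> \<open>Short enough that every profile stays above \<open>1 / 2\<close> on
    \<open>[0, \<delta>]\<close>. The integral \<open>I\<close> is then at least \<open>c0\<close>,
    the integral of \<open>r ^ (2 * m + 1) / 4\<close> over that interval, whatever the
    amplitude.\<close>
  define \<delta> where "\<delta> = min R (1 / (2 * (C + 1)))"
  have \<delta>: "0 < \<delta>" "\<delta> \<le> R" using R C by (auto simp: \<delta>_def)
  have C\<delta>: "C * \<delta> \<le> 1 / 2"
  proof -
    have "C * \<delta> \<le> C * (1 / (2 * (C + 1)))" using C by (intro mult_left_mono) (auto simp: \<delta>_def)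
    also have "\<dots> \<le> 1 / 2" using C by (simp add: field_simps)
    finally show ?thesis .
  qed
  define c0 where "c0 = \<delta> ^ (?k + 1) / (4 * real (?k + 1))"
  have c0: "c0 > 0" using \<delta> by (simp add: c0_def)
  have I_ge: "I p \<ge> c0" for p
  proof -
    let ?f = "\<lambda>r. r ^ ?k * (w (p, r))\<^sup>2"
    have "((\<lambda>r. r ^ ?k / 4) has_integral (\<delta> ^ (?k + 1) / (4 * real (?k + 1)) - 0 ^ (?k + 1) / (4 * real (?k + 1)))) {0..\<delta>}"
    proof (rule fundamental_theorem_of_calculus)
      fix x :: real
      have "((\<lambda>x. x ^ (?k + 1) / (4 * real (?k + 1))) has_real_derivative
          (real (?k + 1) * x ^ (?k + 1 - Suc 0)) / (4 * real (?k + 1))) (at x within {0..\<delta>})"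
        by (intro DERIV_cdivide DERIV_pow)
      also have "(real (?k + 1) * x ^ (?k + 1 - Suc 0)) / (4 * real (?k + 1)) = x ^ ?k / 4"
        by (simp del: power_Suc of_nat_Suc)
      finally show "((\<lambda>x. x ^ (?k + 1) / (4 * real (?k + 1))) has_vector_derivative x ^ ?k / 4) (at x within {0..\<delta>})"
        by (simp only: has_real_derivative_iff_has_vector_derivative)
    qed (use \<delta> in simp)
    then have 1: "((\<lambda>r. r ^ ?k / 4) has_integral c0) {0..\<delta>}" by (simp add: c0_def)
    have i: "?f integrable_on {0..b}" for b
      by (intro integrable_continuous_real continuous_intros continuous_on_subset[OF c]) auto
    have "c0 \<le> integral {0..\<delta>} ?f"
    proof (rule has_integral_le[OF 1 integrable_integral[OF i]])
      fix r assume r: "r \<in> {0..\<delta>}"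
      have "C * r \<le> C * \<delta>" using r C by (intro mult_left_mono) auto
      then have "1 / 2 \<le> w (p, r)" using w_ge[of r p] C\<delta> r \<delta> by simp
      then have "(1 / 2)\<^sup>2 \<le> (w (p, r))\<^sup>2" by (intro power_mono) auto
      then have "r ^ ?k * (1 / 4) \<le> r ^ ?k * (w (p, r))\<^sup>2"
        using r by (intro mult_left_mono) (auto simp: power2_eq_square)
      then show "r ^ ?k / 4 \<le> ?f r" by simp
    qed
    also have "\<dots> \<le> I p"
      unfolding I_def using \<delta> by (intro integral_subset_le i) auto
    finally show ?thesis .
  qed
  have contI: "continuous_on UNIV I"
  proof -
    have "continuous_on (UNIV \<times> cbox 0 R) (\<lambda>(p, r). r ^ ?k * (w (p, r))\<^sup>2)"
      unfolding case_prod_unfold prod.collapse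
      by (intro continuous_intros continuous_on_subset[OF w(1)]) auto
    from integral_continuous_on_param[OF this] show ?thesis by (simp add: I_def[abs_def])
  qed
  \<comment> \<open>At this amplitude the lower bound \<open>c0\<close> alone already accounts for
    the flux \<open>Q0\<close>.\<close>
  define a1 where "a1 = sqrt (Q0 / (2 * pi * c0))"
  have a1: "a1 \<ge> 0" "2 * pi * a1\<^sup>2 * c0 = Q0" using Q0 c0 by (auto simp: a1_def)
  let ?f = "\<lambda>p. 2 * pi * (fst p)\<^sup>2 * I p - Q0"
  let ?g = "\<lambda>p. INF r\<in>{0..R}. w (p, r)"
  have bdd: "bdd_below ((\<lambda>r. w (p, r)) ` {0..R})" for p
    by (intro bounded_imp_bdd_below compact_imp_bounded compact_continuous_image continuous_on_subset[OF c]) auto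
  obtain a \<kappa> where a: "a \<in> {0..a1}" and \<kappa>: "\<kappa> \<in> {\<kappa>0..\<kappa>1}" and fa: "?f (a, \<kappa>) = 0" and ga: "?g (a, \<kappa>) = 0"
  proof (rule poincare_miranda_plane[of 0 a1 \<kappa>0 \<kappa>1 ?f ?g])
    show "continuous_on ({0..a1} \<times> {\<kappa>0..\<kappa>1}) ?f"
      by (intro continuous_intros continuous_on_subset[OF contI]) auto
    show "continuous_on ({0..a1} \<times> {\<kappa>0..\<kappa>1}) ?g"
      using R by (intro continuous_on_INF_compact compact_Times continuous_on_subset[OF w(1)]) auto
    show "?f (a1, k) \<ge> 0" for k
    proof -
      have "2 * pi * a1\<^sup>2 * c0 \<le> 2 * pi * a1\<^sup>2 * I (a1, k)" using I_ge by (intro mult_left_mono) auto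
      then show ?thesis using a1 by simp
    qed
    show "?g (a, \<kappa>0) \<le> 0" for a
    proof -
      have "\<exists>r\<in>{0..R}. w ((a, \<kappa>0), r) \<le> 0"
        using radial_profile.has_nonpos_value[OF prof R, of "(a, \<kappa>0)"] \<kappa>0 \<kappa>1 big K_id[of \<kappa>0] by simp
      then show ?thesis using cINF_lower2[OF bdd] by blast
    qed
    show "?g (a, \<kappa>1) \<ge> 0" for a
    proof (rule cINF_greatest)
      fix r assume "r \<in> {0..R}"
      moreover have "K \<kappa>1 = \<kappa>1" using \<kappa>0 \<kappa>1 by (intro K_id) auto
      ultimately have "0 < w ((a, \<kappa>1), r)"
        using radial_profile.pos_if_large_kappa[OF prof, of "(a, \<kappa>1)" r] by (simp add: \<kappa>1_def)
      then show "0 \<le> w ((a, \<kappa>1), r)" by simp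
    qed (use R in auto)
  qed (use a1 \<kappa>0 \<kappa>1 Q0 in auto)
  \<comment> \<open>The \<kappa> found lies in the clamping range, so the clamp \<open>K\<close>
    disappears.\<close>
  interpret radial_profile m \<alpha> a \<kappa> "\<lambda>r. w ((a, \<kappa>), r)" "?D (a, \<kappa>)"
    using prof[of "(a, \<kappa>)"] K_id[OF \<kappa>] by simp
  have flux: "flux R u = Q0" using fa by (simp add: flux_u I_def)
  have apos: "a > 0" using fa Q0 a by (cases "a = 0") auto
  have y_nonneg: "w ((a, \<kappa>), r) \<ge> 0" if "r \<in> {0..R}" for r
    using cINF_lower[OF bdd that, of "(a, \<kappa>)"] ga by simp
  obtain r0 where r0: "r0 \<in> {0..R}" "\<And>r. r \<in> {0..R} \<Longrightarrow> w ((a, \<kappa>), r0) \<le> w ((a, \<kappa>), r)"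
    using continuous_attains_inf[of "{0..R}" "\<lambda>r. w ((a, \<kappa>), r)"] R continuous_on_subset[OF c] by (metis atLeastAtMost_iff compact_Icc empty_iff less_eq_real_def order_refl subset_UNIV)
  have "w ((a, \<kappa>), r0) \<le> ?g (a, \<kappa>)" using r0 R by (intro cINF_greatest) auto
  then have zero: "w ((a, \<kappa>), r0) = 0" using ga y_nonneg[OF r0(1)] by simp
  \<comment> \<open>An interior zero of the nonnegative profile would be a minimum, hence a double
    zero; and the profile is \<open>1\<close> at the origin.\<close>
  have end_zero: "r = R" if r: "r \<in> {0..R}" "w ((a, \<kappa>), r) = 0" for r
  proof (rule ccontr)
    assume "r \<noteq> R"
    moreover have "r \<noteq> 0" using w0[of "(a, \<kappa>)"] r by auto
    ultimately have r': "0 < r" "r < R" using r by auto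
    have "?D (a, \<kappa>) r = 0"
    proof (rule DERIV_local_min[OF deriv_y[OF r'(1)]])
      show "0 < min r (R - r)" using r' by simp
      show "\<forall>s. \<bar>r - s\<bar> < min r (R - r) \<longrightarrow> w ((a, \<kappa>), r) \<le> w ((a, \<kappa>), s)"
        using y_nonneg r(2) by (auto simp: abs_less_iff)
    qed
    then show False using no_double_zero[OF r'(1) r(2)] by simp
  qed
  have "w ((a, \<kappa>), R) = 0" using end_zero[OF r0(1) zero] zero by simp
  show ?thesis
  proof (rule that[OF vortex_solution_u finite_energy_u flux])
    fix r assume r: "r \<in> {0<..<R}"
    then have "w ((a, \<kappa>), r) > 0" using y_nonneg[of r] end_zero[of r] by force
    then show "u r > 0" using apos r by (simp add: u_def)
  qed fact+
qed

section \<open>Small flux\<close>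

locale vortex =
  fixes n :: int and \<alpha> R \<kappa> :: real and u :: "real \<Rightarrow> real"
  assumes \<alpha>: "\<alpha> > 0" and R: "R > 0" and sol: "vortex_solution n \<alpha> R \<kappa> u"
    and energy: "finite_energy \<alpha> R u"
begin

abbreviation v :: "real \<Rightarrow> real" where "v \<equiv> deriv u"

text \<open>\<open>r * c r\<close> is the quantity \<open>n\<^sup>2 + 2 r\<^sup>2 \<kappa>\<close>
  assumed positive in the nonexistence claim.\<close>

definition c :: "real \<Rightarrow> real" where "c r = (real_of_int n)\<^sup>2 / r + 2 * \<kappa> * r"

definition N :: "real \<Rightarrow> real" where "N r = 2 * r * (u r) ^ 4 / (1 + \<alpha> * (u r)\<^sup>2)"

text \<open>The boundary term left by integration by parts when the equation is multiplied by
  \<open>u\<close>.\<close>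

definition F :: "real \<Rightarrow> real" where "F r = r * v r * u r"

section \<open>Regularity inside the interval and the energy identity\<close>

lemma one_plus_pos: "1 + \<alpha> * (u r)\<^sup>2 > 0"
  using \<alpha> by (simp add: add_pos_nonneg)

lemma one_plus_neq: "1 + \<alpha> * (u r)\<^sup>2 \<noteq> 0"
  using one_plus_pos[of r] by linarith

lemma cont_u: "continuous_on {0..R} u" and u_R: "u R = 0"
  using sol by (auto simp: vortex_solution_def)

lemma deriv_u: "r \<in> {0<..<R} \<Longrightarrow> (u has_real_derivative v r) (at r)"
  using sol unfolding vortex_solution_def by (simp add: DERIV_deriv_iff_real_differentiable)

lemma deriv_rv:
  assumes "r \<in> {0<..<R}"
  shows "((\<lambda>r. r * v r) has_real_derivative c r * u r - 2 * r * (u r) ^ 3 / (1 + \<alpha> * (u r)\<^sup>2)) (at r)"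
proof -
  have "((\<lambda>r. r * v r) has_real_derivative
      (real_of_int n)\<^sup>2 / r * u r - 2 * r * (u r) ^ 3 / (1 + \<alpha> * (u r)\<^sup>2) + 2 * \<kappa> * r * u r) (at r)"
    using sol assms unfolding vortex_solution_def by blast
  then show ?thesis by (rule DERIV_cong) (simp add: c_def distrib_right)
qed

lemma cont_u': "S \<subseteq> {0<..<R} \<Longrightarrow> continuous_on S u"
  by (rule continuous_on_subset[OF cont_u]) auto

text \<open>Continuity of \<open>u'\<close> comes from the differentiability of \<open>r u'\<close>,
  divided by \<open>r\<close> away from the origin.\<close>

lemma cont_v:
  assumes "S \<subseteq> {0<..<R}"
  shows "continuous_on S v"
proof -
  have "continuous_on S (\<lambda>r. r * v r)"
    using assms by (auto intro!: continuous_at_imp_continuous_on DERIV_isCont[OF deriv_rv])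
  then have "continuous_on S (\<lambda>r. r * v r / r)"
    by (rule continuous_on_divide[OF _ continuous_on_id]) (use assms in auto)
  then show ?thesis by (rule continuous_on_eq) (use assms in force)
qed

lemma cont_c: "S \<subseteq> {0<..<R} \<Longrightarrow> continuous_on S c"
  unfolding c_def by (intro continuous_intros) auto

lemma cont_N: "S \<subseteq> {0<..<R} \<Longrightarrow> continuous_on S N"
  unfolding N_def by (intro continuous_intros cont_u') (auto simp: one_plus_neq)

lemmas cont = cont_u' cont_v cont_c cont_N

lemma deriv_F:
  assumes "r \<in> {0<..<R}"
  shows "(F has_real_derivative r * (v r)\<^sup>2 + c r * (u r)\<^sup>2 - N r) (at r)"
  unfolding F_def
  by (rule DERIV_cong[OF DERIV_mult[OF deriv_rv[OF assms] deriv_u[OF assms]]])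
    (simp add: N_def algebra_simps power2_eq_square power3_eq_cube power4_eq_xxxx)

text \<open>Integrates the derivative of \<open>F\<close> over a compact subinterval of
  \<open>(0, R)\<close>, which keeps clear of both endpoints; the boundary terms are sent to
  \<open>0\<close> later.\<close>

lemma energy_identity:
  assumes ab: "0 < a" "a \<le> b" "b < R"
  shows "integral {a..b} (\<lambda>r. r * (v r)\<^sup>2) + integral {a..b} (\<lambda>r. c r * (u r)\<^sup>2)
    = F b - F a + integral {a..b} N"
proof -
  have sub: "{a..b} \<subseteq> {0<..<R}" using ab by auto
  have i: "(\<lambda>r. r * (v r)\<^sup>2) integrable_on {a..b}" "(\<lambda>r. c r * (u r)\<^sup>2) integrable_on {a..b}"
    "N integrable_on {a..b}"
    by (intro integrable_continuous_real continuous_intros cont sub)+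
  have "((\<lambda>r. r * (v r)\<^sup>2 + c r * (u r)\<^sup>2 - N r) has_integral (F b - F a)) {a..b}"
    using ab deriv_F
    by (intro fundamental_theorem_of_calculus)
      (auto simp: has_real_derivative_iff_has_vector_derivative[symmetric] intro: has_field_derivative_at_within)
  from integral_unique[OF this] show ?thesis
    using i by (simp add: integral_add integral_diff integrable_add)
qed

text \<open>The two one-dimensional bounds \<open>r u\<^sup>2 \<le> S\<close> and \<open>\<integral> u\<^sup>2 \<le> S\<close> with \<open>S = \<integral> 2 r \<bar>u u'\<bar>\<close>
  combine to \<open>\<integral> r u\<^sup>4 \<le> S\<^sup>2\<close>, a radial form of Ladyzhenskaya's inequality; the boundary value at \<open>b\<close>
  enters through \<open>\<rho>\<close>.\<close>

lemma weighted_square_bounds: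
  assumes ab: "0 < a" "a \<le> b" "b < R"
  defines "S \<equiv> integral {a..b} (\<lambda>r. 2 * r * \<bar>u r * v r\<bar>)" and "\<rho> \<equiv> R * (u b)\<^sup>2"
  shows "\<And>r. r \<in> {a..b} \<Longrightarrow> r * (u r)\<^sup>2 \<le> \<rho> + S"
    and "integral {a..b} (\<lambda>r. (u r)\<^sup>2) \<le> \<rho> + S"
proof -
  have sub: "{a..b} \<subseteq> {0<..<R}" using ab by auto
  let ?s = "\<lambda>r. 2 * r * \<bar>u r * v r\<bar>"
  have si: "?s integrable_on {x..b}" if "a \<le> x" for x
    using that ab by (intro integrable_continuous_real continuous_intros cont) auto
  have \<rho>: "b * (u b)\<^sup>2 \<le> \<rho>" unfolding \<rho>_def using ab by (intro mult_right_mono) auto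
  show "r * (u r)\<^sup>2 \<le> \<rho> + S" if r: "r \<in> {a..b}" for r
  proof -
    \<comment> \<open>Integrate the derivative of \<open>u\<^sup>2\<close> from \<open>r\<close> to
      \<open>b\<close> and multiply by \<open>r\<close>, which is at most the integration
      variable.\<close>
    have "((\<lambda>s. 2 * u s * v s) has_integral ((u b)\<^sup>2 - (u r)\<^sup>2)) {r..b}"
      using r ab
      by (intro fundamental_theorem_of_calculus)
        (auto simp: has_real_derivative_iff_has_vector_derivative[symmetric]
          intro!: derivative_eq_intros has_field_derivative_at_within[OF deriv_u])
    then have "((\<lambda>s. (- r) * (2 * u s * v s)) has_integral (- r) * ((u b)\<^sup>2 - (u r)\<^sup>2)) {r..b}"
      by (rule has_integral_mult_right)
    then have "(- r) * ((u b)\<^sup>2 - (u r)\<^sup>2) \<le> integral {r..b} ?s"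
    proof (rule has_integral_le[OF _ integrable_integral[OF si]])
      fix s assume s: "s \<in> {r..b}"
      have "- r * (u s * v s) \<le> r * \<bar>u s * v s\<bar>"
        using mult_left_mono[OF abs_ge_minus_self[of "u s * v s"], of r] r ab by simp
      also have "\<dots> \<le> s * \<bar>u s * v s\<bar>" using s by (intro mult_right_mono) auto
      finally show "(- r) * (2 * u s * v s) \<le> ?s s" by (simp add: mult_ac)
    qed (use r in auto)
    also have "\<dots> \<le> S"
      unfolding S_def using r ab by (intro integral_subset_le si) auto
    finally have "r * (u r)\<^sup>2 \<le> r * (u b)\<^sup>2 + S" by (simp add: algebra_simps)
    also have "r * (u b)\<^sup>2 \<le> b * (u b)\<^sup>2" using r by (intro mult_right_mono) auto
    finally show ?thesis using \<rho> by simp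
  qed
  have i2: "(\<lambda>r. (u r)\<^sup>2) integrable_on {a..b}"
    by (intro integrable_continuous_real continuous_intros cont sub)
  \<comment> \<open>The same for the derivative of \<open>r u\<^sup>2\<close>, whose first term is
    the \<open>u\<^sup>2\<close> to be bounded.\<close>
  have "((\<lambda>r. (u r)\<^sup>2 + 2 * r * (u r * v r)) has_integral (b * (u b)\<^sup>2 - a * (u a)\<^sup>2)) {a..b}"
    using ab
    by (intro fundamental_theorem_of_calculus)
      (auto simp: has_real_derivative_iff_has_vector_derivative[symmetric]
          intro!: derivative_eq_intros has_field_derivative_at_within[OF deriv_u])
  then have "integral {a..b} (\<lambda>r. (u r)\<^sup>2 - ?s r) \<le> b * (u b)\<^sup>2 - a * (u a)\<^sup>2"
  proof (intro has_integral_le[OF integrable_integral[OF integrable_diff[OF i2 si]]])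
    fix r assume r: "r \<in> {a..b}"
    have "- (r * (u r * v r)) \<le> r * \<bar>u r * v r\<bar>"
      using mult_left_mono[OF abs_ge_minus_self[of "u r * v r"], of r] r ab by simp
    then show "(u r)\<^sup>2 - ?s r \<le> (u r)\<^sup>2 + 2 * r * (u r * v r)" unfolding mult.assoc[of 2 r] by linarith
  qed auto
  then have "integral {a..b} (\<lambda>r. (u r)\<^sup>2) - S \<le> b * (u b)\<^sup>2 - a * (u a)\<^sup>2"
    using integral_diff[OF i2 si[of a]] by (simp add: S_def)
  moreover have "0 \<le> a * (u a)\<^sup>2" using ab by simp
  ultimately show "integral {a..b} (\<lambda>r. (u r)\<^sup>2) \<le> \<rho> + S" using \<rho> by simp
qed

text \<open>In the energy identity the integral of \<open>N\<close> is at most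
  \<open>2 (\<rho> + S)\<^sup>2 \<le> 4 \<rho>\<^sup>2 + 4 S\<^sup>2\<close>, and small flux gives
  \<open>4 S\<^sup>2 \<le> B + \<epsilon>\<close>; the Dirichlet integral \<open>B\<close> cancels
  and only boundary terms survive.\<close>

lemma potential_integral_le:
  assumes ab: "0 < a" "a \<le> b" "b < R" and A: "integral {a..b} (\<lambda>r. r * (u r)\<^sup>2) \<le> 1 / 24"
  shows "integral {a..b} (\<lambda>r. c r * (u r)\<^sup>2) \<le> \<bar>F a\<bar> + (\<bar>F b\<bar> + 4 * (R * (u b)\<^sup>2)\<^sup>2)"
proof (rule field_le_epsilon)
  fix \<epsilon> :: real assume \<epsilon>: "\<epsilon> > 0"
  have sub: "{a..b} \<subseteq> {0<..<R}" using ab by auto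
  define S where "S = integral {a..b} (\<lambda>r. 2 * r * \<bar>u r * v r\<bar>)"
  define \<rho> where "\<rho> = R * (u b)\<^sup>2"
  define B where "B = integral {a..b} (\<lambda>r. r * (v r)\<^sup>2)"
  note bounds = weighted_square_bounds[OF ab, folded S_def \<rho>_def]
  have i: "(\<lambda>r. r * (u r)\<^sup>2) integrable_on {a..b}" "(\<lambda>r. r * (v r)\<^sup>2) integrable_on {a..b}"
    "(\<lambda>r. 2 * r * \<bar>u r * v r\<bar>) integrable_on {a..b}" "(\<lambda>r. (u r)\<^sup>2) integrable_on {a..b}" "N integrable_on {a..b}"
    by (intro integrable_continuous_real continuous_intros cont sub)+
  have B: "B \<ge> 0" unfolding B_def using ab by (intro integral_nonneg i) auto
  have S: "S \<ge> 0" unfolding S_def using ab by (intro integral_nonneg i) auto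
  have \<rho>: "\<rho> \<ge> 0" using R by (simp add: \<rho>_def)
  \<comment> \<open>The \<epsilon> keeps \<open>q\<close> positive even when \<open>B = 0\<close>,
    so that it can serve as a weight.\<close>
  define q where "q = sqrt (B + \<epsilon>)"
  have q: "q > 0" "q\<^sup>2 = B + \<epsilon>" using B \<epsilon> by (auto simp: q_def)
  \<comment> \<open>Young's inequality
    \<open>2 \<bar>u v\<bar> \<le> 4 q u\<^sup>2 + v\<^sup>2 / (4 q)\<close> replaces
    Cauchy-Schwarz. With the flux bound \<open>1 / 24\<close> the two terms are at most
    \<open>q / 6\<close> and \<open>q / 4\<close>, together below \<open>q / 2\<close>.\<close>
  have "S \<le> 4 * q * integral {a..b} (\<lambda>r. r * (u r)\<^sup>2) + B / (4 * q)"
  proof -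
    have "S \<le> integral {a..b} (\<lambda>r. 4 * q * (r * (u r)\<^sup>2) + r * (v r)\<^sup>2 / (4 * q))"
      unfolding S_def
    proof (rule integral_le)
      fix r assume r: "r \<in> {a..b}"
      have "0 \<le> (4 * q * \<bar>u r\<bar> - \<bar>v r\<bar>)\<^sup>2 / (4 * q)" using q by simp
      also have "\<dots> = 4 * q * (u r)\<^sup>2 + (v r)\<^sup>2 / (4 * q) - 2 * \<bar>u r * v r\<bar>"
        using q by (simp add: power2_diff abs_mult field_simps power2_eq_square)
      finally have "r * (2 * \<bar>u r * v r\<bar>) \<le> r * (4 * q * (u r)\<^sup>2 + (v r)\<^sup>2 / (4 * q))"
        using r ab by (intro mult_left_mono) auto
      then show "2 * r * \<bar>u r * v r\<bar> \<le> 4 * q * (r * (u r)\<^sup>2) + r * (v r)\<^sup>2 / (4 * q)"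
        by (simp add: algebra_simps)
    qed (intro i integrable_add integrable_on_mult_right integrable_on_divide)+
    also have "\<dots> = 4 * q * integral {a..b} (\<lambda>r. r * (u r)\<^sup>2) + B / (4 * q)"
      unfolding B_def using i by (simp add: integral_add integrable_on_mult_right integrable_on_divide)
    finally show ?thesis .
  qed
  also have "\<dots> \<le> 4 * q * (1 / 24) + q\<^sup>2 / (4 * q)"
    using q \<epsilon> A by (intro add_mono mult_left_mono divide_right_mono) auto
  also have "q\<^sup>2 / (4 * q) = q / 4" using q(1) by (simp add: power2_eq_square)
  also have "4 * q * (1 / 24) + q / 4 \<le> q / 2" using q(1) by simp
  finally have Sq: "S \<le> q / 2" .
  have "integral {a..b} N \<le> integral {a..b} (\<lambda>r. 2 * (\<rho> + S) * (u r)\<^sup>2)"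
  proof (rule integral_le)
    fix r assume r: "r \<in> {a..b}"
    have "N r \<le> 2 * r * (u r) ^ 4 / 1"
      unfolding N_def using r ab \<alpha> by (intro divide_left_mono) (auto simp: add_pos_nonneg)
    also have "\<dots> = 2 * (r * (u r)\<^sup>2) * (u r)\<^sup>2" by (simp add: power2_eq_square power4_eq_xxxx)
    also have "\<dots> \<le> 2 * (\<rho> + S) * (u r)\<^sup>2" using bounds(1)[OF r] by (intro mult_right_mono) auto
    finally show "N r \<le> 2 * (\<rho> + S) * (u r)\<^sup>2" .
  qed (intro i integrable_on_mult_right)+
  also have "\<dots> = 2 * (\<rho> + S) * integral {a..b} (\<lambda>r. (u r)\<^sup>2)" by simp
  also have "\<dots> \<le> 2 * (\<rho> + S) * (\<rho> + S)" using bounds(2) \<rho> S by (intro mult_left_mono) auto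
  also have "\<dots> \<le> 4 * \<rho>\<^sup>2 + 4 * S\<^sup>2" using sum_squares_bound[of \<rho> S] by (simp add: algebra_simps power2_eq_square)
  also have "4 * S\<^sup>2 \<le> 4 * (q / 2)\<^sup>2" using Sq S by (intro mult_left_mono power_mono) auto
  also have "\<dots> = B + \<epsilon>" using q by (simp add: power_divide)
  finally have "integral {a..b} N \<le> 4 * \<rho>\<^sup>2 + (B + \<epsilon>)" by simp
  then show "integral {a..b} (\<lambda>r. c r * (u r)\<^sup>2) \<le> \<bar>F a\<bar> + (\<bar>F b\<bar> + 4 * (R * (u b)\<^sup>2)\<^sup>2) + \<epsilon>"
    using energy_identity[OF ab] unfolding B_def[symmetric] \<rho>_def[symmetric] by linarith
qed

text \<open>Near \<open>R\<close> the equation bounds the derivative of \<open>r u'\<close>, so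
  \<open>r u'\<close> itself is bounded there by the mean value inequality, while \<open>u\<close>
  tends to \<open>0\<close>.\<close>

lemma boundary_terms_small_at_R:
  assumes "\<epsilon> > 0" "b0 < R"
  obtains b where "b0 < b" "b < R" "\<bar>F b\<bar> + 4 * (R * (u b)\<^sup>2)\<^sup>2 < \<epsilon>"
proof -
  let ?g = "\<lambda>r. c r * u r - 2 * r * (u r) ^ 3 / (1 + \<alpha> * (u r)\<^sup>2)"
  have "continuous_on {R / 2..R} ?g"
    unfolding c_def using R
    by (intro continuous_intros continuous_on_subset[OF cont_u]) (auto simp: one_plus_neq)
  then have "bounded (?g ` {R / 2..R})" by (intro compact_imp_bounded compact_continuous_image) auto
  then obtain M where M: "\<And>r. r \<in> {R / 2..R} \<Longrightarrow> \<bar>?g r\<bar> \<le> M"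
    unfolding bounded_iff real_norm_def by blast
  define Q where "Q = \<bar>R / 2 * v (R / 2)\<bar> + M * R"
  have M0: "M \<ge> 0" using order_trans[OF abs_ge_zero M[of R]] R by simp
  have rv: "\<bar>r * v r\<bar> \<le> Q" if r: "r \<in> {R / 2..<R}" for r
  proof -
    have d: "((\<lambda>r. r * v r) has_field_derivative ?g z) (at z within {R / 2..<R})" if "z \<in> {R / 2..<R}" for z
      using that R by (intro has_field_derivative_at_within[OF deriv_rv]) auto
    have n: "norm (?g z) \<le> M" if "z \<in> {R / 2..<R}" for z
      unfolding real_norm_def by (rule M) (use that in auto)
    have r2: "r \<in> {R / 2..<R}" "R / 2 \<in> {R / 2..<R}" using r R by auto
    have 1: "norm (r * v r - R / 2 * v (R / 2)) \<le> M * norm (r - R / 2)"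
      by (rule field_differentiable_bound[OF convex_real_interval(7) d n r2])
    have "\<bar>r - R / 2\<bar> \<le> R" using r R by simp
    then have 2: "M * \<bar>r - R / 2\<bar> \<le> M * R" using M0 by (rule mult_left_mono)
    show ?thesis using 1 2 unfolding Q_def real_norm_def by linarith
  qed
  let ?h = "\<lambda>r. Q * \<bar>u r\<bar> + 4 * (R * (u r)\<^sup>2)\<^sup>2"
  have "continuous_on {0..R} ?h" by (intro continuous_intros cont_u)
  then have "(?h \<longlongrightarrow> ?h R) (at R within {0..R})" using R unfolding continuous_on_def by auto
  then have "(?h \<longlongrightarrow> 0) (at_left R)"
    using R by (simp add: u_R at_within_Icc_at_left)
  then have "\<forall>\<^sub>F r in at_left R. ?h r < \<epsilon>" using \<open>\<epsilon> > 0\<close> by (rule order_tendstoD)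
  moreover have "\<forall>\<^sub>F r in at_left R. r \<in> {max b0 (R / 2)<..<R}"
    using assms R by (intro eventually_at_left_real) auto
  ultimately have "\<forall>\<^sub>F r in at_left R. ?h r < \<epsilon> \<and> r \<in> {max b0 (R / 2)<..<R}" by eventually_elim auto
  then obtain b where b: "?h b < \<epsilon>" "b \<in> {max b0 (R / 2)<..<R}"
    using eventually_happens'[of "at_left R"] by auto
  have "\<bar>F b\<bar> \<le> Q * \<bar>u b\<bar>"
    unfolding F_def abs_mult[of "b * v b"] using rv[of b] b by (intro mult_right_mono) auto
  then show ?thesis using b by (intro that[of b]) auto
qed

text \<open>Otherwise the energy density would dominate a multiple of \<open>1 / r\<close>.\<close>

lemma boundary_term_small_at_0:
  assumes "\<epsilon> > 0" "0 < a0" "a0 < R"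
  obtains a where "0 < a" "a < a0" "\<bar>F a\<bar> < \<epsilon>"
proof (rule ccontr)
  note ex = that
  assume no: "\<not> thesis"
  have F: "\<epsilon> \<le> \<bar>F r\<bar>" if "0 < r" "r < a0" for r using that ex[of r] no by linarith
  have e: "energy_density \<alpha> u r \<ge> 2 * \<epsilon> / r" if r: "0 < r" "r < a0" for r
  proof -
    \<comment> \<open>Completing the square bounds the first two terms of the energy density below
      by \<open>2 \<bar>F r\<bar> / r\<close>.\<close>
    have "0 \<le> (r * \<bar>v r\<bar> - \<bar>u r\<bar>)\<^sup>2 / r" using r by simp
    also have "\<dots> = r * (v r)\<^sup>2 + (u r)\<^sup>2 / r - 2 * \<bar>F r\<bar> / r"
      using r by (simp add: F_def power2_diff abs_mult field_simps power2_eq_square)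
    finally have "2 * \<bar>F r\<bar> / r \<le> r * (v r)\<^sup>2 + (u r)\<^sup>2 / r" by simp
    moreover have "2 * \<epsilon> / r \<le> 2 * \<bar>F r\<bar> / r" using F[OF r] r by (intro divide_right_mono) auto
    moreover have "0 \<le> r * ln (1 + \<alpha> * (u r)\<^sup>2)" using r \<alpha> by simp
    ultimately show ?thesis unfolding energy_density_def by linarith
  qed
  define E where "E = (\<integral>r\<in>{0<..<R}. energy_density \<alpha> u r \<partial>lborel)"
  have bound: "2 * \<epsilon> * (ln (a0 / 2) - ln \<delta>) \<le> E" if \<delta>: "0 < \<delta>" "\<delta> \<le> a0 / 2" for \<delta>
  proof -
    have int: "set_integrable lborel {0<..<R} (energy_density \<alpha> u)"
      using energy by (simp add: finite_energy_def)
    have sub: "{\<delta>..a0 / 2} \<subseteq> {0<..<R}" using \<delta> assms by auto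
    have int': "set_integrable lborel {\<delta>..a0 / 2} (energy_density \<alpha> u)"
      by (rule set_integrable_subset[OF int _ sub]) simp
    have "((\<lambda>r. 2 * \<epsilon> / r) has_integral (2 * \<epsilon> * ln (a0 / 2) - 2 * \<epsilon> * ln \<delta>)) {\<delta>..a0 / 2}"
      using \<delta> by (intro fundamental_theorem_of_calculus)
        (auto simp: has_real_derivative_iff_has_vector_derivative[symmetric] intro!: derivative_eq_intros)
    then have "2 * \<epsilon> * ln (a0 / 2) - 2 * \<epsilon> * ln \<delta> \<le> integral {\<delta>..a0 / 2} (energy_density \<alpha> u)"
      by (rule has_integral_le[OF _ integrable_integral[OF set_borel_integral_eq_integral(1)[OF int']]])
        (use \<delta> assms e in auto)
    also have "\<dots> = (\<integral>r\<in>{\<delta>..a0 / 2}. energy_density \<alpha> u r \<partial>lborel)"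
      by (rule set_borel_integral_eq_integral(2)[OF int', symmetric])
    also have "\<dots> \<le> E"
      unfolding E_def set_lebesgue_integral_def
    proof (rule integral_mono)
      fix r
      have "0 \<le> energy_density \<alpha> u r" if "0 < r"
        unfolding energy_density_def using that \<alpha> by (intro add_nonneg_nonneg) auto
      then show "indicat_real {\<delta>..a0 / 2} r *\<^sub>R energy_density \<alpha> u r \<le> indicat_real {0<..<R} r *\<^sub>R energy_density \<alpha> u r"
        using sub by (auto simp: indicator_def)
    qed (use int int' in \<open>simp_all add: set_integrable_def\<close>)
    finally show ?thesis by (simp add: right_diff_distrib)
  qed
  \<comment> \<open>Chosen so that the logarithmic lower bound equals
    \<open>\<bar>E\<bar> + 1\<close>, which exceeds \<open>E\<close>.\<close>
  define \<delta> where "\<delta> = a0 / 2 * exp (- ((\<bar>E\<bar> + 1) / (2 * \<epsilon>)))"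
  have "0 < \<delta>" "\<delta> \<le> a0 / 2" using assms by (auto simp: \<delta>_def mult_left_le)
  moreover have "ln \<delta> = ln (a0 / 2) - (\<bar>E\<bar> + 1) / (2 * \<epsilon>)"
    unfolding \<delta>_def by (subst ln_mult) (use assms in auto)
  ultimately have "2 * \<epsilon> * ((\<bar>E\<bar> + 1) / (2 * \<epsilon>)) \<le> E"
    using bound[of \<delta>] by simp
  then show False using assms by simp
qed

text \<open>As the outer interval \<open>[a, b]\<close> exhausts \<open>(0, R)\<close>, the boundary
  terms force the integral of \<open>c u\<^sup>2\<close> over a fixed interval around
  \<open>x\<close> to be \<open>0\<close>; since \<open>c\<close> is positive, the continuous
  integrand and hence \<open>u\<close> vanish at \<open>x\<close>.\<close>

lemma trivial_if_small_flux:
  assumes pos: "\<And>r. r \<in> {0..R} \<Longrightarrow> (real_of_int n)\<^sup>2 + 2 * r\<^sup>2 * \<kappa> > 0" and flux: "flux R u \<le> 1 / 4"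
    and x: "x \<in> {0<..<R}"
  shows "u x = 0"
proof -
  have c_pos: "c r > 0" if "r \<in> {0<..<R}" for r
  proof -
    have "c r = ((real_of_int n)\<^sup>2 + 2 * r\<^sup>2 * \<kappa>) / r"
      using that by (simp add: c_def field_simps power2_eq_square)
    then show ?thesis using pos[of r] that by simp
  qed
  have ci: "continuous_on {0..R} (\<lambda>r. r * (u r)\<^sup>2)" by (intro continuous_intros cont_u)
  \<comment> \<open>The constant is \<open>(1 / 4) / (2 * 3)\<close>, from the flux bound and
    \<open>pi > 3\<close>.\<close>
  have A: "integral {a..b} (\<lambda>r. r * (u r)\<^sup>2) \<le> 1 / 24" if ab: "0 < a" "a \<le> b" "b < R" for a b
  proof -
    have "integral {a..b} (\<lambda>r. r * (u r)\<^sup>2) \<le> integral {0..R} (\<lambda>r. r * (u r)\<^sup>2)"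
      using ab by (intro integral_subset_le integrable_continuous_real continuous_on_subset[OF ci]) auto
    also have "\<dots> = flux R u / (2 * pi)"
      unfolding flux_def
      by (simp add: set_borel_integral_eq_integral(2)[OF borel_integrable_atLeastAtMost'[OF ci]])
    also have "\<dots> \<le> (1 / 4) / (2 * 3)"
      using flux pi_gt3 by (intro frac_le) (auto simp: flux_def set_lebesgue_integral_def)
    finally show ?thesis by simp
  qed
  define a0 where "a0 = x / 2"
  define b0 where "b0 = (x + R) / 2"
  have ab0: "0 < a0" "a0 < x" "x < b0" "b0 < R" using x by (auto simp: a0_def b0_def)
  let ?f = "\<lambda>r. c r * (u r)\<^sup>2"
  have f: "continuous_on {a..b} ?f" if "0 < a" "b < R" for a b
    using that by (intro continuous_intros cont) auto
  have f0: "?f r \<ge> 0" if "r \<in> {0<..<R}" for r using c_pos[OF that] by simp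
  have "integral {a0..b0} ?f \<le> 0"
  proof (rule field_le_epsilon)
    fix \<epsilon> :: real assume \<epsilon>: "\<epsilon> > 0"
    obtain a where a: "0 < a" "a < a0" "\<bar>F a\<bar> < \<epsilon> / 2"
      using boundary_term_small_at_0[of "\<epsilon> / 2" a0] \<epsilon> ab0 by auto
    obtain b where b: "b0 < b" "b < R" "\<bar>F b\<bar> + 4 * (R * (u b)\<^sup>2)\<^sup>2 < \<epsilon> / 2"
      using boundary_terms_small_at_R[of "\<epsilon> / 2" b0] \<epsilon> ab0 by auto
    have "integral {a0..b0} ?f \<le> integral {a..b} ?f"
      using a b ab0 by (intro integral_subset_le integrable_continuous_real f) (auto intro!: f0 simp del: zero_le_mult_iff)
    also have "\<dots> \<le> \<epsilon>" using potential_integral_le[of a b] A[of a b] a b ab0 by simp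
    finally show "integral {a0..b0} ?f \<le> 0 + \<epsilon>" by simp
  qed
  moreover have "integral {a0..b0} ?f \<ge> 0"
    using ab0 by (intro integral_nonneg integrable_continuous_real f f0) auto
  ultimately have "integral {a0..b0} ?f = 0" by simp
  then have "?f x = 0"
    using integral_eq_0_iff[OF f[OF ab0(1,4)]] f0 ab0 by auto
  then show ?thesis using c_pos[OF x] by simp
qed

end


theorem theorem3p1:
  fixes n :: int and \<alpha> R Q0 :: real
  assumes "\<bar>n\<bar> \<ge> 1" and "\<alpha> > 0" and "R > 0" and "Q0 > 0"
  shows "(\<exists>u \<kappa>. vortex_solution n \<alpha> R \<kappa> u \<and> finite_energy \<alpha> R u \<and> flux R u = Q0
              \<and> (\<forall>r\<in>{0<..<R}. u r > 0))
       \<and> (\<forall>\<kappa>. (\<forall>r\<in>{0..R}. (real_of_int n)\<^sup>2 + 2 * r\<^sup>2 * \<kappa> > 0) \<longrightarrow> Q0 \<le> 1/4 \<longrightarrow>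
            \<not> (\<exists>u. vortex_solution n \<alpha> R \<kappa> u \<and> finite_energy \<alpha> R u
                   \<and> (\<exists>r\<in>{0..R}. u r \<noteq> 0) \<and> flux R u = Q0))"
proof (rule conjI)
  show "\<exists>u \<kappa>. vortex_solution n \<alpha> R \<kappa> u \<and> finite_energy \<alpha> R u \<and> flux R u = Q0
      \<and> (\<forall>r\<in>{0<..<R}. u r > 0)"
    using exists_positive_vortex[OF assms] by metis
next
  show "\<forall>\<kappa>. (\<forall>r\<in>{0..R}. (real_of_int n)\<^sup>2 + 2 * r\<^sup>2 * \<kappa> > 0) \<longrightarrow> Q0 \<le> 1/4 \<longrightarrow>
      \<not> (\<exists>u. vortex_solution n \<alpha> R \<kappa> u \<and> finite_energy \<alpha> R u
          \<and> (\<exists>r\<in>{0..R}. u r \<noteq> 0) \<and> flux R u = Q0)"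
  proof (intro allI impI notI, elim exE conjE bexE)
    fix \<kappa> u r
    assume "\<forall>r\<in>{0..R}. (real_of_int n)\<^sup>2 + 2 * r\<^sup>2 * \<kappa> > 0" "Q0 \<le> 1 / 4" "flux R u = Q0"
      "vortex_solution n \<alpha> R \<kappa> u" "finite_energy \<alpha> R u" "r \<in> {0..R}" "u r \<noteq> 0"
    moreover from this interpret vortex n \<alpha> R \<kappa> u by unfold_locales (use assms in auto)
    \<comment> \<open>Nontriviality is stated on the closed interval, so the endpoints are settled
      by the boundary conditions.\<close>
    have "u 0 = 0" using sol by (simp add: vortex_solution_def)
    ultimately show False
      using trivial_if_small_flux[of r] u_R by (cases "r = 0 \<or> r = R") auto
  qed
qed

end
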